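(* Let $n\ge 2$. The distance function $d$ on $B_T^n$ arising from the length functional $\mathcal{L}$ is given, for all $p,q\in B_T^n$, by \[ d(p,q) = \tanh^{-1}\bigl(\|p\|_T\bigr) + \tanh^{-1}\bigl(\|q\|_T\bigr) - 2\tanh^{-1}\bigl(\|m\|_T\bigr), \] where $m = m(p,q)$.
   Context: For $v \in \mathbb{R}^n$ let $\|v\|_T = \sum_{i=1}^n |v_i|$, and let $B_T^n = \{x \in \mathbb{R}^n : \|x\|_T < 1\}$. $\Gamma(p,q)$ is the set of maps $\gamma : [0,1] \to B_T^n$ all of whose components are absolutely continuous, with $\gamma(0)=p$ and $\gamma(1)=q$. The length of such a curve is $\mathcal{L}(\gamma) = \int_0^1 \frac{\|\gamma'(t)\|_T}{1-\|\gamma(t)\|_T^2}\,dt$. The distance function arising from $\mathcal{L}$ is $d(p,q) = \inf_{\gamma\in\Gamma(p,q)} \mathcal{L}(\gamma)$. Minimal point: for real $x,y$ let $\operatorname{sgn}(x) \in \{1,-1,0\}$ be the sign of $x$ (with $\operatorname{sgn}(0)=0$) and let $\ell(x,y) = \operatorname{sgn}(x)\min\{|x|,|y|\}$ if $\operatorname{sgn}(x)=\operatorname{sgn}(y)$, and $\ell(x,y)=0$ otherwise. For $p,q \in B_T^n$, $m(p,q) \in B_T^n$ is the point with coordinates $m_i(p,q) = \ell(p_i,q_i)$. *)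

theory Defs
  imports "HOL-Analysis.Analysis"
begin

definition taxi_norm :: "real ^ 'n \<Rightarrow> real" where
  "taxi_norm v = (\<Sum>i\<in>UNIV. \<bar>v $ i\<bar>)"

definition taxi_ball :: "(real ^ 'n) set" where
  "taxi_ball = {x. taxi_norm x < 1}"

text \<open>
  The usual epsilon-delta definition of absolute continuity. A division \<open>D\<close> of some \<open>T \<subseteq> S\<close> is
  precisely a finite family of non-overlapping compact intervals \<open>[Inf K, Sup K]\<close> contained in
  \<open>S\<close>; degenerate intervals are allowed and contribute 0 to both sums.
\<close>

definition abs_continuous_on :: "real set \<Rightarrow> (real \<Rightarrow> real) \<Rightarrow> bool" where
  "abs_continuous_on S f \<longleftrightarrow>
    (\<forall>\<epsilon>>0. \<exists>\<delta>>0. \<forall>D T. D division_of T \<and> T \<subseteq> S \<and> (\<Sum>K\<in>D. Sup K - Inf K) < \<delta> \<longrightarrow>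
       (\<Sum>K\<in>D. \<bar>f (Sup K) - f (Inf K)\<bar>) < \<epsilon>)"

text \<open>
  A curve \<open>[0,1] \<rightarrow> \<real>\<^sup>n\<close> is a total function on the reals of which only the values on
  \<open>{0..1}\<close> matter.
\<close>

definition taxi_curves :: "real ^ 'n \<Rightarrow> real ^ 'n \<Rightarrow> (real \<Rightarrow> real ^ 'n) set" where
  "taxi_curves p q = {\<gamma>. \<gamma> ` {0..1} \<subseteq> taxi_ball \<and>
     (\<forall>i. abs_continuous_on {0..1} (\<lambda>t. \<gamma> t $ i)) \<and> \<gamma> 0 = p \<and> \<gamma> 1 = q}"

text \<open>
  A curve in \<open>taxi_curves p q\<close> is differentiable almost everywhere with integrable derivative, and
  its image is a compact subset of the open ball, so the integrand below is integrable and the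
  arbitrary value of \<open>vector_derivative\<close> at points of non-differentiability is irrelevant.
\<close>

definition taxi_length :: "(real \<Rightarrow> real ^ 'n) \<Rightarrow> real" where
  "taxi_length \<gamma> =
    (LINT t:{0..1}|lebesgue.
       taxi_norm (vector_derivative \<gamma> (at t within {0..1})) / (1 - (taxi_norm (\<gamma> t))\<^sup>2))"

text \<open>
  For \<open>p\<close> and \<open>q\<close> in the ball the infimum ranges over a nonempty set of nonnegative reals, since
  the ball is convex.
\<close>

definition taxi_dist :: "real ^ 'n \<Rightarrow> real ^ 'n \<Rightarrow> real" where
  "taxi_dist p q = (INF \<gamma>\<in>taxi_curves p q. taxi_length \<gamma>)"

definition min_coord :: "real \<Rightarrow> real \<Rightarrow> real" where
  "min_coord x y = (if sgn x = sgn y then sgn x * min \<bar>x\<bar> \<bar>y\<bar> else 0)"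

definition min_point :: "real ^ 'n \<Rightarrow> real ^ 'n \<Rightarrow> real ^ 'n" where
  "min_point p q = (\<chi> i. min_coord (p $ i) (q $ i))"

end

theory Submission
  imports Defs
begin

text \<open>
  Fix \<open>p\<close> and let \<open>F x = artanh \<parallel>p\<parallel> + artanh \<parallel>x\<parallel> - 2 artanh \<parallel>m(p,x)\<parallel>\<close>. For the lower bound, write
  \<open>\<parallel>x\<parallel> = \<mu> + \<nu>\<close> with \<open>\<mu> = \<parallel>m(p,x)\<parallel>\<close>: when one coordinate of \<open>x\<close> moves, exactly one of \<open>\<mu>\<close> and \<open>\<nu>\<close> moves,
  with the same speed, and convexity of \<open>artanh\<close> on \<open>[0,1)\<close> shows that \<open>F\<close> changes at rate at most
  \<open>1 / (1 - \<parallel>x\<parallel>\<^sup>2)\<close>. Hence \<open>F p = 0\<close> and the fundamental theorem of calculus for the absolutely continuous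
  function \<open>F \<circ> \<gamma>\<close> give \<open>F q \<le> L(\<gamma>)\<close> for every curve \<open>\<gamma>\<close> from \<open>p\<close> to \<open>q\<close>. Equality holds for the path
  consisting of the two segments from \<open>p\<close> to \<open>m(p,q)\<close> and from \<open>m(p,q)\<close> to \<open>q\<close>, along each of which
  all \<open>\<bar>x\<^sub>i\<bar>\<close> are monotone.

  Absolutely continuous functions are handled through their positive variation, whose
  Lebesgue--Stieltjes measure has a density by the Radon--Nikodym theorem; the derivative is
  identified with that density by Lebesgue differentiation.
\<close>

section \<open>Absolutely continuous functions\<close>

definition incr :: "(real \<Rightarrow> real) \<Rightarrow> real set set \<Rightarrow> real" where
  "incr f D = (\<Sum>K\<in>D. f (Sup K) - f (Inf K))"

lemma division_real_memE:
  fixes D :: "real set set"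
  assumes "D division_of T" "K \<in> D"
  obtains u v where "u \<le> v" "K = {u..v}" "Sup K = v" "Inf K = u" "u \<in> T" "v \<in> T"
proof -
  obtain u v where K: "K = {u..v}"
    using division_ofD(4)[OF assms] by (metis box_real(2))
  moreover have "K \<noteq> {}" "K \<subseteq> T"
    using division_ofD(2,3)[OF assms] by auto
  ultimately show ?thesis
    by (intro that[of u v]) auto
qed

lemma sum_length_division:
  fixes D :: "real set set"
  assumes "D division_of T"
  shows "(\<Sum>K\<in>D. Sup K - Inf K) = measure lebesgue T"
proof -
  have "Sup K - Inf K = measure lebesgue K" if "K \<in> D" for K
  proof -
    obtain u v where "u \<le> v" "K = {u..v}" "Sup K = v" "Inf K = u"
      using division_real_memE[OF assms \<open>K \<in> D\<close>] by metis
    then show ?thesis by simp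
  qed
  then show ?thesis using content_division[OF assms] by simp
qed

text \<open>The right-hand sum is indexed by \<open>D\<close> rather than by the traces, so that the
  restrictions to two adjacent intervals can be added term by term.\<close>

lemma incr_restrict:
  fixes D :: "real set set"
  assumes D: "D division_of T" and "a \<le> b"
  obtains D' where "D' division_of (T \<inter> {a..b})"
    "incr f D' = (\<Sum>K\<in>D. if K \<inter> {a..b} = {} then 0 else f (Sup (K \<inter> {a..b})) - f (Inf (K \<inter> {a..b})))"
proof -
  define D' where "D' = {k1 \<inter> k2 |k1 k2. k1 \<in> D \<and> k2 \<in> {{a..b}} \<and> k1 \<inter> k2 \<noteq> {}}"
  have div: "D' division_of (T \<inter> {a..b})"
    unfolding D'_def using \<open>a \<le> b\<close>
    by (intro division_inter D division_of_self[of a b, unfolded box_real]) auto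
  define E where "E = {K \<in> D. K \<inter> {a..b} \<noteq> {}}"
  have D'_eq: "D' = (\<lambda>K. K \<inter> {a..b}) ` E"
    unfolding D'_def E_def by blast
  have fin: "finite D" using D by blast
  have "incr f D' = (\<Sum>K\<in>E. f (Sup (K \<inter> {a..b})) - f (Inf (K \<inter> {a..b})))"
    unfolding incr_def D'_eq
  proof (subst sum.reindex_nontrivial)
    show "finite E" using fin by (simp add: E_def)
    \<comment> \<open>Distinct members of \<open>D\<close> can only have the same trace on \<open>{a..b}\<close> if it is a single point.\<close>
    fix K L assume KL: "K \<in> E" "L \<in> E" "K \<noteq> L" "K \<inter> {a..b} = L \<inter> {a..b}"
    have "interior K \<inter> interior L = {}"
      using division_ofD(5)[OF D] KL unfolding E_def by blast
    hence "interior (K \<inter> {a..b}) = {}"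
      using KL(4) by (metis interior_Int inf.idem inf_assoc inf_bot_left inf_left_commute)
    moreover have "K \<inter> {a..b} \<in> D'" using KL D'_eq by blast
    then obtain u v where "u \<le> v" "K \<inter> {a..b} = {u..v}" 
      using division_real_memE[OF div] by metis
    ultimately show "f (Sup (K \<inter> {a..b})) - f (Inf (K \<inter> {a..b})) = 0"
      by simp
  qed simp
  also have "\<dots> = (\<Sum>K\<in>D. if K \<inter> {a..b} = {} then 0 else f (Sup (K \<inter> {a..b})) - f (Inf (K \<inter> {a..b})))"
    unfolding E_def using fin by (subst sum.inter_filter) (auto intro!: sum.cong)
  finally show ?thesis using div that by blast
qed

text \<open>A member of \<open>D\<close> that contains \<open>b\<close> is cut there, and its
  increment telescopes through \<open>f b\<close>; any other member lies entirely in one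
  half.\<close>

lemma incr_split:
  fixes D :: "real set set"
  assumes D: "D division_of T" "T \<subseteq> {a..c}" and "a \<le> b" "b \<le> c"
  obtains D1 T1 D2 T2 where "D1 division_of T1" "T1 \<subseteq> {a..b}" "D2 division_of T2" "T2 \<subseteq> {b..c}"
    "incr f D = incr f D1 + incr f D2"
proof -
  obtain D1 where D1: "D1 division_of (T \<inter> {a..b})" "incr f D1 = (\<Sum>K\<in>D. if K \<inter> {a..b} = {} then 0 else f (Sup (K \<inter> {a..b})) - f (Inf (K \<inter> {a..b})))"
    using incr_restrict[OF D(1) \<open>a \<le> b\<close>] by blast
  obtain D2 where D2: "D2 division_of (T \<inter> {b..c})" "incr f D2 = (\<Sum>K\<in>D. if K \<inter> {b..c} = {} then 0 else f (Sup (K \<inter> {b..c})) - f (Inf (K \<inter> {b..c})))"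
    using incr_restrict[OF D(1) \<open>b \<le> c\<close>] by blast
  have "incr f D = incr f D1 + incr f D2"
    unfolding D1(2) D2(2) sum.distrib[symmetric] unfolding incr_def
  proof (rule sum.cong[OF refl])
    fix K assume "K \<in> D"
    then obtain u v where K: "u \<le> v" "K = {u..v}" "u \<in> T" "v \<in> T"
      using division_real_memE[OF D(1)] by metis
    hence "a \<le> u" "v \<le> c" using D(2) by auto
    then show "f (Sup K) - f (Inf K) = (if K \<inter> {a..b} = {} then 0 else f (Sup (K \<inter> {a..b})) - f (Inf (K \<inter> {a..b}))) +
      (if K \<inter> {b..c} = {} then 0 else f (Sup (K \<inter> {b..c})) - f (Inf (K \<inter> {b..c})))"
      using K(1) by (cases "b < u"; cases "v < b") (auto simp: K(2) min_def max_def)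
  qed
  then show ?thesis using D1(1) D2(1) that by blast
qed

text \<open>On an interval shorter than \<open>\<delta>\<close>, absolute continuity with tolerance
  1 bounds every increment sum by 1, and finitely many such intervals cover \<open>{a..b}\<close>.
  The resulting bound is what makes the supremum in the positive variation meaningful.\<close>

lemma abs_continuous_on_bounded_incr:
  assumes "abs_continuous_on {a..b} f" "a \<le> b"
  obtains M where "\<And>D T. D division_of T \<Longrightarrow> T \<subseteq> {a..b} \<Longrightarrow> incr f D \<le> M"
proof -
  obtain \<delta> where "\<delta> > 0" and \<delta>: "\<And>D T. D division_of T \<Longrightarrow> T \<subseteq> {a..b} \<Longrightarrow> (\<Sum>K\<in>D. Sup K - Inf K) < \<delta> \<Longrightarrow>
       (\<Sum>K\<in>D. \<bar>f (Sup K) - f (Inf K)\<bar>) < 1"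
    using assms(1) unfolding abs_continuous_on_def by (meson zero_less_one)
  have short: "incr f D \<le> 1" if "D division_of T" "T \<subseteq> {u..v}" "{u..v} \<subseteq> {a..b}" "v - u < \<delta>" for D T u v
  proof (cases "T = {}")
    case False
    hence "u \<le> v" using that by auto
    have "(\<Sum>K\<in>D. Sup K - Inf K) = measure lebesgue T"
      by (rule sum_length_division[OF that(1)])
    also have "\<dots> \<le> measure lebesgue {u..v}"
      using that by (intro measure_mono_fmeasurable fmeasurableD lmeasurable_division[OF that(1)]) auto
    also have "\<dots> < \<delta>" using that \<open>u \<le> v\<close> by simp
    finally have "(\<Sum>K\<in>D. \<bar>f (Sup K) - f (Inf K)\<bar>) < 1" using \<delta> that by blast
    moreover have "incr f D \<le> (\<Sum>K\<in>D. \<bar>f (Sup K) - f (Inf K)\<bar>)"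
      unfolding incr_def by (intro sum_mono) auto
    ultimately show ?thesis by linarith
  qed (use that in \<open>auto simp: incr_def\<close>)
  \<comment> \<open>Half of \<open>\<delta>\<close>, because the smallness condition on lengths is
    strict.\<close>
  define h where "h = \<delta> / 2"
  have h: "h > 0" "h < \<delta>" using \<open>\<delta> > 0\<close> by (auto simp: h_def)
  \<comment> \<open>Each further piece of length at most \<open>h\<close> costs at most 1; the cap
    at \<open>b\<close> lets the last piece be shorter.\<close>
  have step: "incr f D \<le> real n" if "D division_of T" "T \<subseteq> {a..min b (a + real n * h)}" for n D T
    using that
  proof (induction n arbitrary: D T)
    case 0
    have "f (Sup K) - f (Inf K) \<le> 0" if "K \<in> D" for K
    proof -
      have "T \<subseteq> {a}" using 0(2) \<open>a \<le> b\<close> by auto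
      moreover obtain u v where "Sup K = v" "Inf K = u" "u \<in> T" "v \<in> T"
        using division_real_memE[OF 0(1) \<open>K \<in> D\<close>] by metis
      ultimately have "Sup K = a" "Inf K = a" by blast+
      then show ?thesis by simp
    qed
    then show ?case by (simp add: incr_def sum_nonpos)
  next
    case (Suc n)
    let ?c = "min b (a + real n * h)" and ?d = "min b (a + real (Suc n) * h)"
    have "a \<le> ?c" "?c \<le> ?d" "?d - ?c < \<delta>" "?d \<le> b" using h \<open>a \<le> b\<close> by (auto simp: min_def algebra_simps)
    obtain D1 T1 D2 T2 where *: "D1 division_of T1" "T1 \<subseteq> {a..?c}" "D2 division_of T2" "T2 \<subseteq> {?c..?d}"
    "incr f D = incr f D1 + incr f D2"
      using incr_split[OF Suc.prems \<open>a \<le> ?c\<close> \<open>?c \<le> ?d\<close>] by metis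
    have "incr f D2 \<le> 1"
      using short[OF *(3,4)] \<open>?d - ?c < \<delta>\<close> \<open>a \<le> ?c\<close> \<open>?d \<le> b\<close> by auto
    with Suc.IH[OF *(1,2)] *(5) show ?case by simp
  qed
  obtain n where "b - a < real n * h" using reals_Archimedean3[OF h(1)] by blast
  hence "min b (a + real n * h) = b" by auto
  with step[where n=n] show ?thesis using that by metis
qed

section \<open>The positive variation of an absolutely continuous function\<close>

text \<open>Since \<open>incr\<close> is signed and \<open>T\<close> may be any part of
  \<open>{a..x}\<close>, stretches on which \<open>f\<close> decreases can be left out; hence this
  is the positive and not the total variation.\<close>

definition positive_variation :: "(real \<Rightarrow> real) \<Rightarrow> real \<Rightarrow> real \<Rightarrow> real" where
  "positive_variation f a x = Sup {incr f D | D T. D division_of T \<and> T \<subseteq> {a..x}}"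

lemma positive_variation_least:
  assumes "\<And>D T. D division_of T \<Longrightarrow> T \<subseteq> {a..x} \<Longrightarrow> incr f D \<le> M"
  shows "positive_variation f a x \<le> M"
  unfolding positive_variation_def
proof (rule cSup_least)
  have "{} division_of ({} :: real set)" by simp
  then show "{incr f D | D T. D division_of T \<and> T \<subseteq> {a..x}} \<noteq> {}" by blast
qed (use assms in auto)

text \<open>A member common to both divisions has empty interior, so it is a single point and
  contributes 0.\<close>

lemma incr_union:
  fixes D E :: "real set set"
  assumes "D division_of S" "E division_of T" "interior S \<inter> interior T = {}"
  shows "incr f (D \<union> E) = incr f D + incr f E"
  unfolding incr_def
proof (rule sum.union_inter_neutral)
  show "\<forall>K\<in>D \<inter> E. f (Sup K) - f (Inf K) = 0"
  proof
    fix K assume K: "K \<in> D \<inter> E"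
    then obtain u v where uv: "u \<le> v" "K = {u..v}"
      using division_real_memE[OF assms(1)] by (metis IntD1)
    have "interior K \<subseteq> interior S \<inter> interior T"
      using K division_ofD(2)[OF assms(1)] division_ofD(2)[OF assms(2)] by (simp add: interior_mono)
    then show "f (Sup K) - f (Inf K) = 0" using uv assms(3) by auto
  qed
qed (use assms division_of_finite in auto)

context
  fixes f :: "real \<Rightarrow> real" and a b :: real
  assumes ac: "abs_continuous_on {a..b} f" and ab: "a \<le> b"
begin

lemma positive_variation_upper:
  assumes "D division_of T" "T \<subseteq> {a..x}" "x \<le> b"
  shows "incr f D \<le> positive_variation f a x"
proof -
  obtain M where M: "\<And>D T. D division_of T \<Longrightarrow> T \<subseteq> {a..b} \<Longrightarrow> incr f D \<le> M"
    using abs_continuous_on_bounded_incr[OF ac ab] by metis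
  show ?thesis unfolding positive_variation_def
  proof (rule cSup_upper)
    show "bdd_above {incr f D |D T. D division_of T \<and> T \<subseteq> {a..x}}"
    proof (rule bdd_aboveI[of _ M], clarify)
      fix D T assume "D division_of T" "T \<subseteq> {a..x}"
      moreover from this have "T \<subseteq> {a..b}" using assms(3) by force
      ultimately show "incr f D \<le> M" by (intro M)
    qed
    show "incr f D \<in> {incr f D |D T. D division_of T \<and> T \<subseteq> {a..x}}"
      using assms by blast
  qed
qed

text \<open>Appending \<open>{x..y}\<close> to any division below \<open>x\<close> gains
  \<open>f y - f x\<close>. This makes the positive variation minus \<open>f\<close> nondecreasing,
  which yields the Jordan decomposition.\<close>

lemma positive_variation_increment_ge:
  assumes "a \<le> x" "x \<le> y" "y \<le> b"
  shows "positive_variation f a y - positive_variation f a x \<ge> f y - f x"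
proof -
  have "positive_variation f a x \<le> positive_variation f a y - (f y - f x)"
  proof (rule positive_variation_least)
    fix D T assume D: "D division_of T" "T \<subseteq> {a..x}"
    have E: "{{x..y}} division_of {x..y}" using assms division_of_self[of x y] by simp
    have disj: "interior T \<inter> interior {x..y} = {}"
    proof -
      have "interior T \<subseteq> {a<..<x}" using interior_mono[OF D(2)] by simp
      then show ?thesis by (auto simp: interior_atLeastAtMost_real)
    qed
    have "T \<union> {x..y} \<subseteq> {a..y}" using D(2) assms by auto
    then have "incr f (D \<union> {{x..y}}) \<le> positive_variation f a y"
      by (rule positive_variation_upper[OF division_disjoint_union[OF D(1) E disj] _ assms(3)])
    moreover have "incr f {{x..y}} = f y - f x" using assms by (simp add: incr_def)
    ultimately show "incr f D \<le> positive_variation f a y - (f y - f x)"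
      using incr_union[OF D(1) E disj, of f] by linarith
  qed
  then show ?thesis by simp
qed

lemma positive_variation_mono:
  assumes "a \<le> x" "x \<le> y" "y \<le> b"
  shows "positive_variation f a x \<le> positive_variation f a y"
proof (rule positive_variation_least)
  fix D T assume "D division_of T" "T \<subseteq> {a..x}"
  moreover from this have "T \<subseteq> {a..y}" using assms by force
  ultimately show "incr f D \<le> positive_variation f a y" using positive_variation_upper assms by blast
qed

text \<open>Cut a nearly optimal division for \<open>y\<close> at \<open>x\<close>: the part below
  \<open>x\<close> contributes at most the positive variation at \<open>x\<close>, so the part above
  carries the rest.\<close>

lemma positive_variation_increment_approx:
  assumes "a \<le> x" "x \<le> y" "y \<le> b" "e > 0"
  obtains D T where "D division_of T" "T \<subseteq> {x..y}" "positive_variation f a y - positive_variation f a x \<le> incr f D + e"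
proof -
  have "\<exists>D T. D division_of T \<and> T \<subseteq> {a..y} \<and> positive_variation f a y - e \<le> incr f D"
  proof (rule ccontr)
    assume "\<not> ?thesis"
    then have "positive_variation f a y \<le> positive_variation f a y - e" by (intro positive_variation_least) (meson linear)
    then show False using \<open>e > 0\<close> by simp
  qed
  then obtain D T where D: "D division_of T" "T \<subseteq> {a..y}" "positive_variation f a y - e \<le> incr f D"
    by blast
  obtain D1 T1 D2 T2 where *: "D1 division_of T1" "T1 \<subseteq> {a..x}" "D2 division_of T2" "T2 \<subseteq> {x..y}"
    "incr f D = incr f D1 + incr f D2"
    using incr_split[OF D(1,2) assms(1,2)] by metis
  have "incr f D1 \<le> positive_variation f a x" using positive_variation_upper[OF *(1,2)] assms by simp
  with * D show ?thesis using that[OF *(3,4)] by linarith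
qed

text \<open>Each member of \<open>D\<close> is replaced by a division inside it that nearly attains
  the increment of the positive variation. The error is distributed by giving half of
  \<open>e\<close> to the new member and half to the remaining ones.\<close>

lemma incr_positive_variation_approx:
  assumes "D division_of T" "T \<subseteq> {a..b}" "e > 0"
  obtains E S where "E division_of S" "S \<subseteq> T" "incr (positive_variation f a) D \<le> incr f E + e"
proof -
  have "finite D" by (rule division_of_finite[OF assms(1)])
  then have "\<exists>E S. E division_of S \<and> S \<subseteq> T \<and> incr (positive_variation f a) D \<le> incr f E + e"
    using assms
  proof (induction D arbitrary: T e rule: finite_induct)
    case empty
    then have "{} division_of ({} :: real set)" by simp
    then show ?case using empty by (intro exI[of _ "{}"]) (auto simp: incr_def)
  next
    case (insert K D)
    obtain u v where K: "u \<le> v" "K = {u..v}" "Sup K = v" "Inf K = u" "u \<in> T" "v \<in> T"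
      using division_real_memE[OF insert.prems(1)] by (metis insertI1)
    have D: "D division_of \<Union>D" by (rule division_of_subset[OF division_of_union_self[OF insert.prems(1)] subset_insertI])
    have T: "T = K \<union> \<Union>D" using division_ofD(6)[OF insert.prems(1)] by auto
    obtain E S where E: "E division_of S" "S \<subseteq> \<Union>D" "incr (positive_variation f a) D \<le> incr f E + e/2"
    proof -
      have "\<Union>D \<subseteq> {a..b}" "e/2 > 0" using insert.prems(2,3) T by auto
      from insert.IH[OF D this] show thesis using that by metis
    qed
    have uv: "a \<le> u" "v \<le> b" "e/2 > 0" using K insert.prems(2,3) by auto
    obtain E' S' where E': "E' division_of S'" "S' \<subseteq> {u..v}" "positive_variation f a v - positive_variation f a u \<le> incr f E' + e/2"
      using positive_variation_increment_approx[OF uv(1) K(1) uv(2,3)] by metis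
    have "interior K \<inter> interior (\<Union>D) = {}"
    proof (rule Int_interior_Union_intervals)
      show "\<exists>a b. L = cbox a b" if "L \<in> D" for L
        using division_ofD(4)[OF D that] by blast
      show "interior K \<inter> interior L = {}" if "L \<in> D" for L
        using division_ofD(5)[OF insert.prems(1), of K L] that insert.hyps by blast
    qed (use insert.hyps(1) in auto)
    hence disj: "interior S \<inter> interior S' = {}"
      using interior_mono[OF E(2)] interior_mono[OF E'(2)] K(2) by blast
    have "incr (positive_variation f a) (insert K D) = (positive_variation f a v - positive_variation f a u) + incr (positive_variation f a) D"
      using insert.hyps K by (simp add: incr_def)
    also have "\<dots> \<le> incr f (E \<union> E') + e"
      using E(3) E'(3) incr_union[OF E(1) E'(1) disj, of f] by simp
    finally have "incr (positive_variation f a) (insert K D) \<le> incr f (E \<union> E') + e" .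
    moreover have "S \<union> S' \<subseteq> T" using E(2) E'(2) K(2) T by auto
    ultimately show ?case
      using division_disjoint_union[OF E(1) E'(1) disj] by metis
  qed
  then show ?thesis using that by metis
qed

text \<open>An increment sum of the positive variation exceeds by at most
  \<open>\<epsilon>/2\<close> an increment sum of \<open>f\<close> over a division of a subset.
  Passing to a subset does not increase total length, so the \<open>\<delta>\<close> that serves
  \<open>f\<close> with tolerance \<open>\<epsilon>/2\<close> works again.\<close>

lemma abs_continuous_on_positive_variation: "abs_continuous_on {a..b} (positive_variation f a)"
  unfolding abs_continuous_on_def
proof (intro allI impI)
  fix \<epsilon> :: real assume "\<epsilon> > 0"
  then obtain \<delta> where "\<delta> > 0" and \<delta>: "\<And>D T. D division_of T \<Longrightarrow> T \<subseteq> {a..b} \<Longrightarrow> (\<Sum>K\<in>D. Sup K - Inf K) < \<delta> \<Longrightarrow>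
       (\<Sum>K\<in>D. \<bar>f (Sup K) - f (Inf K)\<bar>) < \<epsilon>/2"
    using ac unfolding abs_continuous_on_def by (meson half_gt_zero)
  have "(\<Sum>K\<in>D. \<bar>positive_variation f a (Sup K) - positive_variation f a (Inf K)\<bar>) < \<epsilon>"
    if D: "D division_of T \<and> T \<subseteq> {a..b} \<and> (\<Sum>K\<in>D. Sup K - Inf K) < \<delta>" for D T
  proof -
    have "(\<Sum>K\<in>D. \<bar>positive_variation f a (Sup K) - positive_variation f a (Inf K)\<bar>) = incr (positive_variation f a) D"
      unfolding incr_def
    proof (rule sum.cong[OF refl])
      fix K assume "K \<in> D"
      then obtain u v where K: "u \<le> v" "K = {u..v}" "Sup K = v" "Inf K = u" "u \<in> T" "v \<in> T"
        using division_real_memE[of D T K] D by metis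
      have "positive_variation f a u \<le> positive_variation f a v" using positive_variation_mono[of u v] K(1,5,6) D by (meson atLeastAtMost_iff subset_iff)
      then show "\<bar>positive_variation f a (Sup K) - positive_variation f a (Inf K)\<bar> = positive_variation f a (Sup K) - positive_variation f a (Inf K)"
        using K by simp
    qed
    moreover obtain E S where E: "E division_of S" "S \<subseteq> T" "incr (positive_variation f a) D \<le> incr f E + \<epsilon>/2"
      using incr_positive_variation_approx[of D T "\<epsilon>/2"] D \<open>\<epsilon> > 0\<close> half_gt_zero by metis
    moreover have "measure lebesgue S \<le> measure lebesgue T"
      using lmeasurable_division[OF E(1)] lmeasurable_division[of D T] D E(2)
      by (intro measure_mono_fmeasurable fmeasurableD) metis+
    hence "(\<Sum>K\<in>E. Sup K - Inf K) < \<delta>" "S \<subseteq> {a..b}"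
      using sum_length_division[OF E(1)] sum_length_division[of D T] D E(2) by (metis order_le_less_trans, metis subset_trans)
    hence "(\<Sum>K\<in>E. \<bar>f (Sup K) - f (Inf K)\<bar>) < \<epsilon>/2" by (intro \<delta>[OF E(1)])
    moreover have "incr f E \<le> (\<Sum>K\<in>E. \<bar>f (Sup K) - f (Inf K)\<bar>)"
      unfolding incr_def by (intro sum_mono) auto
    ultimately show ?thesis by linarith
  qed
  with \<open>\<delta> > 0\<close> show "\<exists>\<delta>>0. \<forall>D T. D division_of T \<and> T \<subseteq> {a..b} \<and> (\<Sum>K\<in>D. Sup K - Inf K) < \<delta> \<longrightarrow>
       (\<Sum>K\<in>D. \<bar>positive_variation f a (Sup K) - positive_variation f a (Inf K)\<bar>) < \<epsilon>"
    by blast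
qed

end

section \<open>Closure properties of absolute continuity\<close>

text \<open>Summing the domination over a division transfers smallness from the \<open>F i\<close>
  to \<open>h\<close>. Lipschitz functions, differences and the potential along a curve are all
  instances.\<close>

lemma abs_continuous_on_dominated:
  fixes F :: "'i \<Rightarrow> real \<Rightarrow> real"
  assumes F: "\<And>i. i \<in> I \<Longrightarrow> abs_continuous_on S (F i)" and "finite I"
    and h: "\<And>x y. x \<in> S \<Longrightarrow> y \<in> S \<Longrightarrow> \<bar>h y - h x\<bar> \<le> C * (\<Sum>i\<in>I. \<bar>F i y - F i x\<bar>)"
  shows "abs_continuous_on S h"
  unfolding abs_continuous_on_def
proof (intro allI impI)
  fix \<epsilon> :: real assume "\<epsilon> > 0"
  \<comment> \<open>\<open>C'\<close> is positive whatever the sign of \<open>C\<close>, and the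
    extra 1 beside \<open>card I\<close> makes the final estimate strict and covers an empty
    \<open>I\<close>.\<close>
  define C' where "C' = \<bar>C\<bar> + 1"
  define e where "e = \<epsilon> / (C' * (real (card I) + 1))"
  have "C' > 0" by (simp add: C'_def)
  then have "e > 0" using \<open>\<epsilon> > 0\<close> by (simp add: e_def)
  have "\<forall>i\<in>I. \<exists>\<delta>>0. \<forall>D T. D division_of T \<and> T \<subseteq> S \<and> (\<Sum>K\<in>D. Sup K - Inf K) < \<delta> \<longrightarrow>
       (\<Sum>K\<in>D. \<bar>F i (Sup K) - F i (Inf K)\<bar>) < e"
    using F \<open>e > 0\<close> unfolding abs_continuous_on_def by meson
  then obtain \<delta> where \<delta>: "\<And>i. i \<in> I \<Longrightarrow> \<delta> i > 0"
    "\<And>i D T. i \<in> I \<Longrightarrow> D division_of T \<Longrightarrow> T \<subseteq> S \<Longrightarrow> (\<Sum>K\<in>D. Sup K - Inf K) < \<delta> i \<Longrightarrow>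
       (\<Sum>K\<in>D. \<bar>F i (Sup K) - F i (Inf K)\<bar>) < e"
    by metis
  define d where "d = Min (insert 1 (\<delta> ` I))"
  have "d > 0" unfolding d_def using \<open>finite I\<close> \<delta>(1) by (subst Min_gr_iff) auto
  have d_le: "d \<le> \<delta> i" if "i \<in> I" for i unfolding d_def using that \<open>finite I\<close> by (intro Min_le) auto
  have "(\<Sum>K\<in>D. \<bar>h (Sup K) - h (Inf K)\<bar>) < \<epsilon>"
    if D: "D division_of T" "T \<subseteq> S" "(\<Sum>K\<in>D. Sup K - Inf K) < d" for D T
  proof -
    have "(\<Sum>K\<in>D. \<bar>h (Sup K) - h (Inf K)\<bar>) \<le> (\<Sum>K\<in>D. C' * (\<Sum>i\<in>I. \<bar>F i (Sup K) - F i (Inf K)\<bar>))"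
    proof (rule sum_mono)
      fix K assume "K \<in> D"
      then have "Sup K \<in> S" "Inf K \<in> S" using division_real_memE[OF D(1) \<open>K \<in> D\<close>] D(2) by (metis subset_iff)+
      then have "\<bar>h (Sup K) - h (Inf K)\<bar> \<le> C * (\<Sum>i\<in>I. \<bar>F i (Sup K) - F i (Inf K)\<bar>)" by (intro h)
      also have "\<dots> \<le> C' * (\<Sum>i\<in>I. \<bar>F i (Sup K) - F i (Inf K)\<bar>)"
        unfolding C'_def by (intro mult_right_mono sum_nonneg) auto
      finally show "\<bar>h (Sup K) - h (Inf K)\<bar> \<le> C' * (\<Sum>i\<in>I. \<bar>F i (Sup K) - F i (Inf K)\<bar>)" .
    qed
    also have "\<dots> = C' * (\<Sum>i\<in>I. \<Sum>K\<in>D. \<bar>F i (Sup K) - F i (Inf K)\<bar>)"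
      unfolding sum_distrib_left[symmetric] by (subst sum.swap) simp
    also have "\<dots> \<le> C' * (\<Sum>i\<in>I. e)"
    proof (intro mult_left_mono sum_mono)
      fix i assume "i \<in> I"
      then show "(\<Sum>K\<in>D. \<bar>F i (Sup K) - F i (Inf K)\<bar>) \<le> e"
        using \<delta>(2)[OF \<open>i \<in> I\<close> D(1,2)] d_le[OF \<open>i \<in> I\<close>] D(3) by linarith
    qed (use \<open>C' > 0\<close> in simp)
    also have "\<dots> < C' * ((real (card I) + 1) * e)"
      using \<open>C' > 0\<close> \<open>e > 0\<close> by simp
    also have "\<dots> = \<epsilon>" unfolding e_def using \<open>C' > 0\<close>
      by (simp add: field_simps add_nonneg_eq_0_iff)
    finally show ?thesis .
  qed
  with \<open>d > 0\<close> show "\<exists>\<delta>>0. \<forall>D T. D division_of T \<and> T \<subseteq> S \<and> (\<Sum>K\<in>D. Sup K - Inf K) < \<delta> \<longrightarrow>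
       (\<Sum>K\<in>D. \<bar>h (Sup K) - h (Inf K)\<bar>) < \<epsilon>"
    by meson
qed

lemma abs_continuous_on_lipschitz:
  assumes "\<And>x y. x \<in> S \<Longrightarrow> y \<in> S \<Longrightarrow> \<bar>h y - h x\<bar> \<le> C * \<bar>y - x\<bar>"
  shows "abs_continuous_on S h"
proof (rule abs_continuous_on_dominated[where I = "{()}" and F = "\<lambda>_ x. x" and C = C])
  have "(\<Sum>K\<in>D. \<bar>Sup K - Inf K\<bar>) = (\<Sum>K\<in>D. Sup K - Inf K)" if "D division_of T" for D and T :: "real set"
  proof (rule sum.cong[OF refl])
    fix K assume "K \<in> D"
    then obtain u v where "u \<le> v" "Sup K = v" "Inf K = u" using division_real_memE[OF \<open>D division_of T\<close> \<open>K \<in> D\<close>] by metis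
    then show "\<bar>Sup K - Inf K\<bar> = Sup K - Inf K" by simp
  qed
  then show "abs_continuous_on S (\<lambda>x. x)" unfolding abs_continuous_on_def by metis
qed (use assms in auto)

lemma abs_continuous_on_diff:
  assumes "abs_continuous_on S f" "abs_continuous_on S g"
  shows "abs_continuous_on S (\<lambda>x. f x - g x)"
  by (rule abs_continuous_on_dominated[where I = UNIV and F = "\<lambda>c. if c then f else g" and C = 1])
     (use assms in \<open>auto simp: UNIV_bool\<close>)

section \<open>Lebesgue differentiation of indefinite integrals\<close>

lemma integral_has_real_derivative_ae:
  fixes g :: "real \<Rightarrow> real"
  assumes g: "g integrable_on {a..b}"
  obtains N where "negligible N"
    "\<And>x. x \<in> {a..b} - N \<Longrightarrow> ((\<lambda>x. integral {a..x} g) has_real_derivative g x) (at x within {a..b})"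
proof -
  \<comment> \<open>Extension by zero makes the function integrable on every compact interval,
    including those that reach beyond \<open>a\<close> or \<open>b\<close>.\<close>
  define G where "G x = (if x \<in> {a..b} then g x else 0)" for x
  have GU: "G integrable_on UNIV" unfolding G_def[abs_def] using g by (simp only: integrable_restrict_UNIV)
  then have G: "G integrable_on {u..v}" for u v by (rule integrable_on_subinterval) simp
  \<comment> \<open>The library differentiates indefinite integrals from the right only; reflection gives the left derivative.\<close>
  define G' where "G' x = G (- x)" for x
  have G': "G' integrable_on {u..v}" for u v 
    unfolding G'_def using G[of "-v" "-u"] Henstock_Kurzweil_Integration.integrable_reflect_real[where f = G and a = "-v" and b = "-u"] by simp
  obtain N1 where N1: "negligible N1"
       "\<And>x e. \<lbrakk>x \<notin> N1; 0 < e\<rbrakk> \<Longrightarrow> \<exists>d>0. \<forall>h. 0 < h \<and> h < d \<longrightarrow> \<bar>integral {x..x + h} G / h - G x\<bar> < e"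
    using integrable_ccontinuous_explicit[of G] G by (auto simp: divide_inverse_commute)
  obtain N2 where N2: "negligible N2"
       "\<And>x e. \<lbrakk>x \<notin> N2; 0 < e\<rbrakk> \<Longrightarrow> \<exists>d>0. \<forall>h. 0 < h \<and> h < d \<longrightarrow> \<bar>integral {x..x + h} G' / h - G' x\<bar> < e"
    using integrable_ccontinuous_explicit[of G'] G' by (auto simp: divide_inverse_commute)
  have G'_int: "integral {-x..-x + h} G' = integral {x - h..x} G" for x h
    unfolding G'_def using Henstock_Kurzweil_Integration.integral_reflect_real[where f = G and a = "x - h" and b = x] by simp
  have diff: "integral {a..y} g - integral {a..x} g = integral {x..y} G"
    if "a \<le> x" "x \<le> y" "y \<le> b" for x y
  proof -
    have "integral {a..y} g = integral {a..x} g + integral {x..y} g"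
      using that by (intro Henstock_Kurzweil_Integration.integral_combine[symmetric] integrable_on_subinterval[OF g]) auto
    moreover have "integral {x..y} g = integral {x..y} G"
      using that by (intro integral_cong) (auto simp: G_def)
    ultimately show ?thesis by simp
  qed
  show ?thesis
  \<comment> \<open>Points of \<open>N1\<close> may lack a right derivative; points whose reflection
    lies in \<open>N2\<close> may lack a left one.\<close>
  proof (rule that[of "N1 \<union> uminus ` N2"])
    show "negligible (N1 \<union> uminus ` N2)"
      using N1(1) N2(1) by (intro negligible_Un negligible_differentiable_image_negligible)
         (auto intro!: derivative_intros)
    fix x assume x: "x \<in> {a..b} - (N1 \<union> uminus ` N2)"
    have "- x \<notin> N2" using x by force
    have "\<exists>d>0. \<forall>y\<in>{a..b}. 0 < dist y x \<and> dist y x < d \<longrightarrow>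
      dist ((integral {a..y} g - integral {a..x} g) / (y - x)) (g x) < e" if "e > 0" for e
    proof -
      obtain d1 where d1: "d1 > 0" "\<And>h. 0 < h \<Longrightarrow> h < d1 \<Longrightarrow> \<bar>integral {x..x + h} G / h - G x\<bar> < e"
        using N1(2)[of x e] x \<open>e > 0\<close> by auto
      obtain d2 where d2: "d2 > 0" "\<And>h. 0 < h \<Longrightarrow> h < d2 \<Longrightarrow> \<bar>integral {x - h..x} G / h - G x\<bar> < e"
        using N2(2)[OF \<open>- x \<notin> N2\<close> \<open>e > 0\<close>] unfolding G'_int by (auto simp: G'_def)
      have "dist ((integral {a..y} g - integral {a..x} g) / (y - x)) (g x) < e"
        if y: "y \<in> {a..b}" "0 < dist y x" "dist y x < min d1 d2" for y
      proof (cases "x < y")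
        case True
        then show ?thesis using d1(2)[of "y - x"] diff[of x y] x y by (auto simp: dist_real_def G_def)
      next
        case False
        then have "(integral {a..y} g - integral {a..x} g) / (y - x) = integral {y..x} G / (x - y)"
          using diff[of y x] x y by (simp add: field_simps dist_real_def)
        then show ?thesis using d2(2)[of "x - y"] x y False by (auto simp: dist_real_def G_def)
      qed
      then show ?thesis using d1(1) d2(1) by (intro exI[of _ "min d1 d2"]) auto
    qed
    then show "((\<lambda>x. integral {a..x} g) has_real_derivative g x) (at x within {a..b})"
      unfolding has_field_derivative_iff Lim_within by blast
  qed
qed

section \<open>Lebesgue-Stieltjes measures and densities\<close>

lemma abs_continuous_on_imp_continuous_on:
  assumes ac: "abs_continuous_on {a..b} f"
  shows "continuous_on {a..b} f"
  unfolding continuous_on_iff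
proof (intro ballI allI impI)
  fix x e :: real assume x: "x \<in> {a..b}" and "e > 0"
  then obtain \<delta> where "\<delta> > 0" and \<delta>: "\<And>D T. D division_of T \<Longrightarrow> T \<subseteq> {a..b} \<Longrightarrow> (\<Sum>K\<in>D. Sup K - Inf K) < \<delta> \<Longrightarrow>
       (\<Sum>K\<in>D. \<bar>f (Sup K) - f (Inf K)\<bar>) < e"
    using ac unfolding abs_continuous_on_def by meson
  have *: "\<bar>f v - f u\<bar> < e" if "u \<le> v" "{u..v} \<subseteq> {a..b}" "v - u < \<delta>" for u v
    using \<delta>[of "{{u..v}}" "{u..v}"] division_of_self[of u v] that by simp
  have "dist (f y) (f x) < e" if y: "y \<in> {a..b}" "dist y x < \<delta>" for y
  proof (cases "x \<le> y")
    case True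
    then show ?thesis using *[of x y] x y by (auto simp: dist_real_def)
  next
    case False
    then show ?thesis using *[of y x] x y by (auto simp: dist_real_def)
  qed
  then show "\<exists>d>0. \<forall>y\<in>{a..b}. dist y x < d \<longrightarrow> dist (f y) (f x) < e"
    using \<open>\<delta> > 0\<close> by blast
qed

text \<open>An open set is an increasing union of finite unions \<open>A n\<close> of compact
  intervals. Each \<open>A n\<close> has a division of total length below \<open>\<delta>\<close>,
  so its measure is at most \<open>e\<close>, and continuity from below passes this bound to
  \<open>U\<close>.\<close>

lemma emeasure_interval_measure_open_le:
  assumes F: "mono F" "continuous_on UNIV F"
    and \<delta>: "\<And>D T. D division_of T \<Longrightarrow> T \<subseteq> S \<Longrightarrow> (\<Sum>K\<in>D. Sup K - Inf K) < \<delta> \<Longrightarrow>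
       (\<Sum>K\<in>D. \<bar>F (Sup K) - F (Inf K)\<bar>) < e"
    and U: "open U" "U \<subseteq> S" "emeasure lborel U < ennreal \<delta>"
  shows "emeasure (interval_measure F) U \<le> ennreal e"
proof (cases "U = {}")
  case False
  obtain \<D> where \<D>: "countable \<D>" "\<D> \<subseteq> Pow U" "\<And>X. X \<in> \<D> \<Longrightarrow> \<exists>a b. X = cbox a b" "\<Union>\<D> = U"
    using open_countable_Union_open_cbox[OF \<open>open U\<close>] by metis
  have "\<D> \<noteq> {}" using \<D>(4) False by auto
  define A where "A n = (\<Union>i\<le>n. from_nat_into \<D> i)" for n
  have XD: "from_nat_into \<D> i \<in> \<D>" for i using \<open>\<D> \<noteq> {}\<close> by (rule from_nat_into)
  have U_eq: "U = (\<Union>n. A n)"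
  proof -
    have "U = (\<Union>i. from_nat_into \<D> i)"
      using \<D>(4) range_from_nat_into[OF \<open>\<D> \<noteq> {}\<close> \<D>(1)] by simp
    then show ?thesis unfolding A_def by auto
  qed
  have AU: "A n \<subseteq> U" for n unfolding U_eq by auto
  have A_sets: "A n \<in> sets borel" for n
    unfolding A_def
  proof (intro sets.finite_UN)
    show "from_nat_into \<D> i \<in> sets borel" for i
      using \<D>(3)[OF XD[of i]] by (metis borel_closed closed_cbox)
  qed simp
  have "emeasure (interval_measure F) (A n) \<le> ennreal e" for n
  proof -
    have fin: "finite (from_nat_into \<D> ` {..n})" by simp
    obtain D where D: "D division_of (A n)"
      using elementary_unions_intervals[OF fin] \<D>(3)[OF XD] unfolding A_def by (metis imageE)
    have K: "\<exists>u v. u \<le> v \<and> K = {u..v} \<and> Sup K = v \<and> Inf K = u" if "K \<in> D" for K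
      using division_real_memE[OF D that] by metis
    have "(\<Sum>K\<in>D. Sup K - Inf K) = measure lborel (A n)"
      using sum_length_division[OF D] A_sets by (simp add: measure_completion)
    moreover have "emeasure lborel (A n) < ennreal \<delta>"
      using emeasure_mono[OF AU, of lborel n] U by (metis borel_open order_le_less_trans sets_lborel)
    hence "measure lborel (A n) < \<delta>"
      using less_top_ennreal unfolding measure_def by (metis (no_types, lifting) enn2real_less_iff ennreal_less_top order.strict_trans)
    ultimately have *: "(\<Sum>K\<in>D. \<bar>F (Sup K) - F (Inf K)\<bar>) < e"
      using \<delta>[OF D] AU U(2) by (metis subset_trans)
    have "emeasure (interval_measure F) (A n) = emeasure (interval_measure F) (\<Union>K\<in>D. K)"
      using division_ofD(6)[OF D] by simp
    also have "\<dots> \<le> (\<Sum>K\<in>D. emeasure (interval_measure F) K)"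
    proof (rule emeasure_subadditive_finite[OF division_of_finite[OF D]])
      show "(\<lambda>K. K) ` D \<subseteq> sets (interval_measure F)"
      proof
        fix L assume "L \<in> (\<lambda>K. K) ` D"
        then obtain u v where "L = {u..v}" using K by auto
        then show "L \<in> sets (interval_measure F)" by simp
      qed
    qed
    also have "\<dots> = (\<Sum>K\<in>D. ennreal \<bar>F (Sup K) - F (Inf K)\<bar>)"
    proof (rule sum.cong[OF refl])
      fix L assume "L \<in> D"
      then obtain u v where "u \<le> v" "L = {u..v}" "Sup L = v" "Inf L = u" using K by metis
      then show "emeasure (interval_measure F) L = ennreal \<bar>F (Sup L) - F (Inf L)\<bar>"
        using emeasure_interval_measure_Icc[OF \<open>u \<le> v\<close> monoD[OF F(1)] F(2)] monoD[OF F(1) \<open>u \<le> v\<close>] by simp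
    qed
    also have "\<dots> = ennreal (\<Sum>K\<in>D. \<bar>F (Sup K) - F (Inf K)\<bar>)" by (rule sum_ennreal) simp
    also have "\<dots> \<le> ennreal e" using * by (intro ennreal_leI) simp
    finally show ?thesis .
  qed
  moreover have "incseq A" unfolding A_def incseq_def by (intro allI impI UN_mono) auto
  hence "(SUP n. emeasure (interval_measure F) (A n)) = emeasure (interval_measure F) (\<Union>n. A n)"
    using A_sets by (intro SUP_emeasure_incseq) auto
  ultimately show ?thesis unfolding U_eq by (metis SUP_least)
qed simp

text \<open>A half-line is a countable union of compact intervals, and those on which
  \<open>F\<close> is constant have measure 0.\<close>

lemma interval_measure_null_sets_half_lines:
  assumes F: "mono F" "continuous_on UNIV F"
  shows "(\<And>x. x \<le> a \<Longrightarrow> F x = F a) \<Longrightarrow> {..a} \<in> null_sets (interval_measure F)"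
    and "(\<And>x. b \<le> x \<Longrightarrow> F x = F b) \<Longrightarrow> {b..} \<in> null_sets (interval_measure F)"
proof -
  note Icc = emeasure_interval_measure_Icc[OF _ monoD[OF F(1)] F(2)]
  have 1: "{..a} = (\<Union>n::nat. {a - real n..a})"
  proof safe
    fix x assume "x \<le> a"
    obtain n where "a - x \<le> real n" using real_arch_simple by blast
    then show "x \<in> (\<Union>n::nat. {a - real n..a})" using \<open>x \<le> a\<close> by (auto intro!: exI[of _ n])
  qed simp
  have 2: "{b..} = (\<Union>n::nat. {b..b + real n})"
  proof safe
    fix x assume "b \<le> x"
    obtain n where "x - b \<le> real n" using real_arch_simple by blast
    then show "x \<in> (\<Union>n::nat. {b..b + real n})" using \<open>b \<le> x\<close> by (auto intro!: exI[of _ n])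
  qed simp
  show "{..a} \<in> null_sets (interval_measure F)" if "\<And>x. x \<le> a \<Longrightarrow> F x = F a"
    unfolding 1
  proof (intro null_sets_UN null_setsI)
    fix n :: nat
    show "emeasure (interval_measure F) {a - real n..a} = 0"
      using that[of "a - real n"] Icc[of "a - real n" a] by simp
  qed simp
  show "{b..} \<in> null_sets (interval_measure F)" if "\<And>x. b \<le> x \<Longrightarrow> F x = F b"
    unfolding 2
  proof (intro null_sets_UN null_setsI)
    fix n :: nat
    show "emeasure (interval_measure F) {b..b + real n} = 0"
      using that[of "b + real n"] Icc[of b "b + real n"] by simp
  qed simp
qed

text \<open>The two outer half-lines are null. Inside \<open>{a<..<b}\<close> outer regularity
  encloses a Lebesgue null set in an open set of length below \<open>\<delta>\<close>, whose
  Stieltjes measure is then at most \<open>e\<close>.\<close>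

lemma absolutely_continuous_interval_measure:
  assumes F: "mono F" "continuous_on UNIV F" and ac: "abs_continuous_on {a..b} F"
    and out: "\<And>x. x \<le> a \<Longrightarrow> F x = F a" "\<And>x. b \<le> x \<Longrightarrow> F x = F b"
  shows "absolutely_continuous lborel (interval_measure F)"
  unfolding absolutely_continuous_def
proof
  fix N :: "real set" assume N: "N \<in> null_sets lborel"
  then have N_borel: "N \<in> sets borel" by (simp add: null_sets_def)
  let ?\<mu> = "interval_measure F"
  have null_out: "{..a} \<in> null_sets ?\<mu>" "{b..} \<in> null_sets ?\<mu>"
    by (intro interval_measure_null_sets_half_lines[OF F], erule out)+
  \<comment> \<open>The summand 0 gives the bound the shape required by
    \<open>ennreal_le_epsilon\<close>.\<close>
  have small: "emeasure ?\<mu> (N \<inter> {a<..<b}) \<le> 0 + ennreal e" if "e > 0" for e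
  proof -
    obtain \<delta> where "\<delta> > 0" and \<delta>: "\<And>D T. D division_of T \<Longrightarrow> T \<subseteq> {a..b} \<Longrightarrow> (\<Sum>K\<in>D. Sup K - Inf K) < \<delta> \<Longrightarrow>
       (\<Sum>K\<in>D. \<bar>F (Sup K) - F (Inf K)\<bar>) < e"
      using ac \<open>e > 0\<close> unfolding abs_continuous_on_def by meson
    obtain U where U: "open U" "N \<subseteq> U" "emeasure lborel (U - N) < ennreal \<delta>"
      by (rule outer_regular_lborel[OF N_borel \<open>\<delta> > 0\<close>])
    have "emeasure lborel (U - N) = emeasure lborel U"
      using U(1) by (intro emeasure_Diff_null_set[OF N]) simp
    moreover have "emeasure lborel (U \<inter> {a<..<b}) \<le> emeasure lborel U"
      using U(1) by (intro emeasure_mono) auto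
    ultimately have U\<delta>: "emeasure lborel (U \<inter> {a<..<b}) < ennreal \<delta>"
      using U(3) by simp
    have U': "open (U \<inter> {a<..<b})" "U \<inter> {a<..<b} \<subseteq> {a..b}" using U(1) by (auto simp: open_Int)
    have "emeasure ?\<mu> (U \<inter> {a<..<b}) \<le> ennreal e"
      by (rule emeasure_interval_measure_open_le[OF F _ U' U\<delta>]) (rule \<delta>)
    moreover have "emeasure ?\<mu> (N \<inter> {a<..<b}) \<le> emeasure ?\<mu> (U \<inter> {a<..<b})"
      using U by (intro emeasure_mono) auto
    ultimately show ?thesis by simp
  qed
  have "emeasure ?\<mu> (N \<inter> {a<..<b}) \<le> 0" by (rule ennreal_le_epsilon) (rule small)
  then have "N \<inter> {a<..<b} \<in> null_sets ?\<mu>" using N_borel by (intro null_setsI) auto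
  then have null: "(N \<inter> {a<..<b}) \<union> {..a} \<union> {b..} \<in> null_sets ?\<mu>"
    using null_out by (intro null_sets.Un)
  show "N \<in> null_sets ?\<mu>" 
  proof (rule null_sets_subset[OF null])
    show "N \<subseteq> (N \<inter> {a<..<b}) \<union> {..a} \<union> {b..}" by auto
  qed (use N_borel in simp)
qed

lemma abs_continuous_mono_density:
  assumes ac: "abs_continuous_on {a..b} P" and ab: "a \<le> b" and mono: "mono_on {a..b} P"
  obtains g where "g absolutely_integrable_on {a..b}"
    "\<And>x. x \<in> {a..b} \<Longrightarrow> (g has_integral (P x - P a)) {a..x}"
proof -
  \<comment> \<open>Clamping the argument to \<open>{a..b}\<close> gives a function that is monotone
    and continuous on the whole line, as a Stieltjes measure requires, and constant outside the
    interval.\<close>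
  define F where "F x = P (max a (min b x))" for x
  have F_eq: "F x = P x" if "x \<in> {a..b}" for x using that by (simp add: F_def)
  have F: "mono F" "continuous_on UNIV F"
  proof -
    show "mono F" unfolding F_def using ab by (intro monoI mono_onD[OF mono]) auto
    show "continuous_on UNIV F" unfolding F_def using ab
      by (intro continuous_on_compose2[OF abs_continuous_on_imp_continuous_on[OF ac]] continuous_intros) auto
  qed
  define \<mu> where "\<mu> = interval_measure F"
  have [simp]: "sets \<mu> = sets borel" by (simp add: \<mu>_def)
  have acF: "abs_continuous_on {a..b} F"
    by (rule abs_continuous_on_dominated[where I = "{()}" and F = "\<lambda>_. P" and C = 1])
       (use ac F_eq in auto)
  have "absolutely_continuous lborel \<mu>"
    unfolding \<mu>_def
  proof (rule absolutely_continuous_interval_measure[OF F acF])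
    show "F x = F a" if "x \<le> a" for x using that ab by (simp add: F_def)
    show "F x = F b" if "b \<le> x" for x using that ab by (simp add: F_def)
  qed
  then obtain g where g[measurable]: "g \<in> borel_measurable lborel" and dens: "density lborel g = \<mu>"
    using sigma_finite_measure.Radon_Nikodym[OF sigma_finite_lborel, of \<mu>] by auto
  have nn: "(\<integral>\<^sup>+y. g y * indicator {a..x} y \<partial>lborel) = ennreal (P x - P a)" if "x \<in> {a..b}" for x
  proof -
    have "(\<integral>\<^sup>+y. g y * indicator {a..x} y \<partial>lborel) = emeasure (density lborel g) {a..x}"
      by (subst emeasure_density) auto
    also have "\<dots> = F x - F a"
      unfolding dens \<mu>_def using that monoD[OF F(1)] F(2) by (intro emeasure_interval_measure_Icc) auto
    finally show ?thesis using that ab F_eq by simp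
  qed
  \<comment> \<open>The Radon-Nikodym density takes extended values, but its integral over
    \<open>{a..b}\<close> is finite. So it is finite almost everywhere there, and
    \<open>enn2real\<close> leaves the integrals unchanged.\<close>
  have "AE y in lborel. g y * indicator {a..b} y \<noteq> \<infinity>"
    by (rule nn_integral_PInf_AE) (use nn[of b] ab in auto)
  then have fin: "AE y in lborel. y \<in> {a..b} \<longrightarrow> g y = ennreal (enn2real (g y))"
    by eventually_elim (auto simp: less_top)
  have int: "((\<lambda>y. enn2real (g y)) has_integral (P x - P a)) {a..x}" if x: "x \<in> {a..b}" for x
  proof -
    have "((\<lambda>y. enn2real (g y) * indicator {a..x} y) has_integral (P x - P a)) UNIV"
    proof (rule nn_integral_has_integral)
      show "0 \<le> P x - P a" using mono_onD[OF mono, of a x] x ab by auto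
      have "(\<integral>\<^sup>+y. ennreal (enn2real (g y) * indicator {a..x} y) \<partial>lborel) = (\<integral>\<^sup>+y. g y * indicator {a..x} y \<partial>lborel)"
        by (rule nn_integral_cong_AE) (use fin x in \<open>auto elim!: eventually_mono simp: indicator_def\<close>)
      then show "(\<integral>\<^sup>+y. ennreal (enn2real (g y) * indicator {a..x} y) \<partial>lborel) = ennreal (P x - P a)"
        using nn[OF x] by simp
    qed (use g in auto)
    then show ?thesis
      by (subst has_integral_restrict_UNIV[symmetric], elim has_integral_eq[rotated]) (auto simp: indicator_def)
  qed
  moreover have "(\<lambda>y. enn2real (g y)) absolutely_integrable_on {a..b}"
    using int[of b] ab by (intro nonnegative_absolutely_integrable_1) auto
  ultimately show ?thesis using that by blast
qed

text \<open>Jordan decomposition: \<open>f\<close> is its positive variation minus the difference of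
  that variation and \<open>f\<close>. Both terms are nondecreasing and absolutely continuous, so
  their densities can be subtracted.\<close>

lemma abs_continuous_density:
  assumes ac: "abs_continuous_on {a..b} f" and ab: "a \<le> b"
  obtains g where "g absolutely_integrable_on {a..b}"
    "\<And>x. x \<in> {a..b} \<Longrightarrow> (g has_integral (f x - f a)) {a..x}"
proof -
  let ?P = "positive_variation f a"
  have acP: "abs_continuous_on {a..b} ?P" by (rule abs_continuous_on_positive_variation[OF ac ab])
  have monoP: "mono_on {a..b} ?P"
    by (intro mono_onI positive_variation_mono[OF ac ab]) auto
  have monoN: "mono_on {a..b} (\<lambda>x. ?P x - f x)"
  proof (rule mono_onI)
    fix x y assume "x \<in> {a..b}" "y \<in> {a..b}" "x \<le> y"
    then show "?P x - f x \<le> ?P y - f y"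
      using positive_variation_increment_ge[OF ac ab, of x y] by simp
  qed
  obtain g1 where g1: "g1 absolutely_integrable_on {a..b}"
    "\<And>x. x \<in> {a..b} \<Longrightarrow> (g1 has_integral (?P x - ?P a)) {a..x}"
    using abs_continuous_mono_density[OF acP ab monoP] by blast
  obtain g2 where g2: "g2 absolutely_integrable_on {a..b}"
    "\<And>x. x \<in> {a..b} \<Longrightarrow> (g2 has_integral ((?P x - f x) - (?P a - f a))) {a..x}"
    using abs_continuous_mono_density[OF abs_continuous_on_diff[OF acP ac] ab monoN] by blast
  show ?thesis
  proof (rule that[of "\<lambda>x. g1 x - g2 x"])
    show "(\<lambda>x. g1 x - g2 x) absolutely_integrable_on {a..b}"
      by (rule set_integral_diff(1)[OF g1(1) g2(1)])
    show "((\<lambda>x. g1 x - g2 x) has_integral (f x - f a)) {a..x}" if "x \<in> {a..b}" for x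
      using has_integral_diff[OF g1(2)[OF that] g2(2)[OF that]] by (simp add: algebra_simps)
  qed
qed

text \<open>On \<open>{a..b}\<close>, \<open>f\<close> is \<open>f a\<close> plus the indefinite
  integral of its density, and Lebesgue differentiation recovers the density as the derivative off a
  null set.\<close>

theorem abs_continuous_fundamental_theorem:
  assumes ac: "abs_continuous_on {a..b} f" and ab: "a \<le> b"
  obtains g N where "g absolutely_integrable_on {a..b}" "(g has_integral (f b - f a)) {a..b}" "negligible N"
    "\<And>x. x \<in> {a..b} - N \<Longrightarrow> (f has_real_derivative g x) (at x within {a..b})"
proof -
  obtain g where g: "g absolutely_integrable_on {a..b}"
    "\<And>x. x \<in> {a..b} \<Longrightarrow> (g has_integral (f x - f a)) {a..x}"
    using abs_continuous_density[OF ac ab] by blast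
  have "g integrable_on {a..b}" using g(1) by (rule set_lebesgue_integral_eq_integral(1))
  then obtain N where N: "negligible N"
    "\<And>x. x \<in> {a..b} - N \<Longrightarrow> ((\<lambda>x. integral {a..x} g) has_real_derivative g x) (at x within {a..b})"
    using integral_has_real_derivative_ae by blast
  show ?thesis
  proof (rule that[OF g(1) _ N(1)])
    show "(g has_integral (f b - f a)) {a..b}" using g(2)[of b] ab by simp
    fix x assume x: "x \<in> {a..b} - N"
    have "((\<lambda>x. f a + integral {a..x} g) has_real_derivative g x) (at x within {a..b})"
      using DERIV_add[OF DERIV_const N(2)[OF x]] by simp
    then show "(f has_real_derivative g x) (at x within {a..b})"
    proof (rule has_field_derivative_transform_within[OF _ zero_less_one])
      show "x \<in> {a..b}" using x by simp
      show "f a + integral {a..y} g = f y" if "y \<in> {a..b}" "dist y x < 1" for y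
        using integral_unique[OF g(2)[OF that(1)]] by simp
    qed
  qed
qed

section \<open>The lower bound\<close>

lemma abs_min_coord_le: "\<bar>min_coord x y\<bar> \<le> \<bar>x\<bar>" "\<bar>min_coord x y\<bar> \<le> \<bar>y\<bar>"
  by (auto simp: min_coord_def abs_mult abs_sgn_eq)

text \<open>While \<open>z\<close> runs between 0 and \<open>c\<close>, only the shared part
  \<open>\<bar>min_coord c z\<bar>\<close> changes; elsewhere only the excess
  \<open>\<bar>z\<bar> - \<bar>min_coord c z\<bar>\<close> does, in both cases at unit speed. The
  two changes therefore share the length \<open>\<bar>y - x\<bar>\<close>.\<close>

lemma min_coord_lipschitz_split:
  fixes c x y :: real
  shows "\<bar>\<bar>min_coord c y\<bar> - \<bar>min_coord c x\<bar>\<bar> +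
     \<bar>(\<bar>y\<bar> - \<bar>min_coord c y\<bar>) - (\<bar>x\<bar> - \<bar>min_coord c x\<bar>)\<bar> \<le> \<bar>y - x\<bar>"
  by (cases c "0::real" rule: linorder_cases; cases x "0::real" rule: linorder_cases;
      cases y "0::real" rule: linorder_cases) (auto simp: min_coord_def min_def)

lemma taxi_norm_nonneg: "0 \<le> taxi_norm v"
  by (simp add: taxi_norm_def sum_nonneg)

lemma artanh_increment_le:
  fixes s t M :: real
  assumes "0 \<le> s" "s \<le> t" "t \<le> M" "M < 1"
  shows "artanh t - artanh s \<le> (t - s) / (1 - M\<^sup>2)"
proof (cases "s = t")
  case False
  then have "s < t" using assms by simp
  have "(artanh has_real_derivative 1 / (1 - x\<^sup>2)) (at x)" if "s \<le> x" "x \<le> t" for x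
    using that assms by (intro artanh_real_has_field_derivative) auto
  then obtain z where z: "s < z" "z < t" "artanh t - artanh s = (t - s) * (1 / (1 - z\<^sup>2))"
    using MVT2[OF \<open>s < t\<close>, of artanh "\<lambda>x. 1 / (1 - x\<^sup>2)"] by blast
  have "z\<^sup>2 \<le> M\<^sup>2" "M\<^sup>2 < 1" using z assms by (auto intro!: power_mono simp: abs_square_less_1)
  then have "1 / (1 - z\<^sup>2) \<le> 1 / (1 - M\<^sup>2)" by (intro divide_left_mono) auto
  then have "(t - s) * (1 / (1 - z\<^sup>2)) \<le> (t - s) * (1 / (1 - M\<^sup>2))" using \<open>s < t\<close> by (intro mult_left_mono) auto
  then show ?thesis using z(3) by simp
qed simp

lemma artanh_mono:
  fixes s t :: real
  assumes "0 \<le> s" "s \<le> t" "t < 1"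
  shows "artanh s \<le> artanh t"
proof (rule DERIV_nonneg_imp_nondecreasing[OF \<open>s \<le> t\<close>])
  fix x assume "s \<le> x" "x \<le> t"
  then have "\<bar>x\<bar> < 1" "x\<^sup>2 < 1" using assms by (auto simp: abs_square_less_1)
  then show "\<exists>y. (artanh has_real_derivative y) (at x) \<and> 0 \<le> y"
    using artanh_real_has_field_derivative[of x UNIV] by (intro exI[of _ "1 / (1 - x\<^sup>2)"]) auto
qed

text \<open>Convexity of \<open>artanh\<close> on \<open>[0,1)\<close>: the increment over a step
  \<open>d\<close> has nonnegative derivative in its starting point.\<close>

lemma artanh_increment_mono:
  fixes s t d :: real
  assumes "0 \<le> s" "s \<le> t" "0 \<le> d" "t + d < 1"
  shows "artanh t - artanh s \<le> artanh (t + d) - artanh (s + d)"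
proof -
  have "artanh (s + d) - artanh s \<le> artanh (t + d) - artanh t"
  proof (rule DERIV_nonneg_imp_nondecreasing[OF \<open>s \<le> t\<close>])
    fix x assume x: "s \<le> x" "x \<le> t"
    have "\<bar>x\<bar> < 1" "\<bar>x + d\<bar> < 1" "(x + d)\<^sup>2 < 1" "x\<^sup>2 \<le> (x + d)\<^sup>2"
      using x assms by (auto simp: abs_square_less_1 intro!: power_mono)
    have "((\<lambda>x. artanh (x + d) - artanh x) has_real_derivative 1 / (1 - (x + d)\<^sup>2) - 1 / (1 - x\<^sup>2)) (at x)"
      using \<open>\<bar>x\<bar> < 1\<close> \<open>\<bar>x + d\<bar> < 1\<close>
      by (intro DERIV_diff artanh_real_has_field_derivative iffD1[OF DERIV_shift])
    moreover have "1 / (1 - x\<^sup>2) \<le> 1 / (1 - (x + d)\<^sup>2)"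
      using \<open>(x + d)\<^sup>2 < 1\<close> \<open>x\<^sup>2 \<le> (x + d)\<^sup>2\<close> by (intro divide_left_mono) auto
    ultimately show "\<exists>y. ((\<lambda>x. artanh (x + d) - artanh x) has_real_derivative y) (at x) \<and> 0 \<le> y"
      by (metis diff_ge_0_iff_ge)
  qed
  then show ?thesis by simp
qed

text \<open>Increasing \<open>\<mu>\<close> raises \<open>artanh (\<mu> + \<nu>)\<close> at least as fast as \<open>artanh \<mu>\<close> by convexity, so the rate
  of \<open>artanh (\<mu> + \<nu>) - 2 * artanh \<mu>\<close> is at most that of \<open>artanh (\<mu> + \<nu>)\<close> in absolute value.\<close>

lemma artanh_split_lipschitz_fst:
  fixes \<alpha> \<beta> \<nu> M :: real
  assumes "0 \<le> \<alpha>" "0 \<le> \<beta>" "0 \<le> \<nu>" "\<alpha> + \<nu> \<le> M" "\<beta> + \<nu> \<le> M" "M < 1"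
  shows "\<bar>(artanh (\<beta> + \<nu>) - 2 * artanh \<beta>) - (artanh (\<alpha> + \<nu>) - 2 * artanh \<alpha>)\<bar> \<le> \<bar>\<beta> - \<alpha>\<bar> / (1 - M\<^sup>2)"
  using assms
proof (induction \<alpha> \<beta> rule: linorder_wlog)
  case (le \<alpha> \<beta>)
  have "artanh \<beta> - artanh \<alpha> \<le> artanh (\<beta> + \<nu>) - artanh (\<alpha> + \<nu>)"
    using le by (intro artanh_increment_mono) auto
  moreover have "artanh (\<beta> + \<nu>) - artanh (\<alpha> + \<nu>) \<le> ((\<beta> + \<nu>) - (\<alpha> + \<nu>)) / (1 - M\<^sup>2)"
    using le by (intro artanh_increment_le) auto
  moreover have "artanh \<alpha> \<le> artanh \<beta>" using le by (intro artanh_mono) auto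
  ultimately show ?case using le by simp
next
  case (sym \<alpha> \<beta>)
  then show ?case by (simp add: abs_minus_commute)
qed

text \<open>The terms \<open>2 * artanh \<alpha>\<close> cancel, leaving a plain increment of
  \<open>artanh\<close>.\<close>

lemma artanh_split_lipschitz_snd:
  fixes \<alpha> \<nu> \<nu>' M :: real
  assumes "0 \<le> \<alpha>" "0 \<le> \<nu>" "0 \<le> \<nu>'" "\<alpha> + \<nu> \<le> M" "\<alpha> + \<nu>' \<le> M" "M < 1"
  shows "\<bar>(artanh (\<alpha> + \<nu>') - 2 * artanh \<alpha>) - (artanh (\<alpha> + \<nu>) - 2 * artanh \<alpha>)\<bar> \<le> \<bar>\<nu>' - \<nu>\<bar> / (1 - M\<^sup>2)"
  using assms
proof (induction \<nu> \<nu>' rule: linorder_wlog)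
  case (le \<nu> \<nu>')
  have "artanh (\<alpha> + \<nu>') - artanh (\<alpha> + \<nu>) \<le> ((\<alpha> + \<nu>') - (\<alpha> + \<nu>)) / (1 - M\<^sup>2)"
    using le by (intro artanh_increment_le) auto
  moreover have "artanh (\<alpha> + \<nu>) \<le> artanh (\<alpha> + \<nu>')" using le by (intro artanh_mono) auto
  ultimately show ?case using le by simp
next
  case (sym \<nu> \<nu>')
  then show ?case by (simp add: abs_minus_commute)
qed

lemma artanh_split_lipschitz:
  fixes \<alpha> \<beta> \<nu> \<nu>' M :: real
  assumes "0 \<le> \<alpha>" "0 \<le> \<beta>" "0 \<le> \<nu>" "0 \<le> \<nu>'" "\<alpha> + \<nu> \<le> M" "\<beta> + \<nu>' \<le> M" "M < 1"
  shows "\<bar>(artanh (\<beta> + \<nu>') - 2 * artanh \<beta>) - (artanh (\<alpha> + \<nu>) - 2 * artanh \<alpha>)\<bar>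
    \<le> (\<bar>\<beta> - \<alpha>\<bar> + \<bar>\<nu>' - \<nu>\<bar>) / (1 - M\<^sup>2)"
proof -
  \<comment> \<open>The variables are changed one at a time, so an intermediate corner must also
    stay below \<open>M\<close>. The two corner sums add up to at most \<open>2 * M\<close>, hence
    one of them qualifies.\<close>
  have "\<beta> + \<nu> \<le> M \<or> \<alpha> + \<nu>' \<le> M" using assms by linarith
  then show ?thesis
  proof
    assume "\<beta> + \<nu> \<le> M"
    then show ?thesis
      using artanh_split_lipschitz_fst[of \<alpha> \<beta> \<nu> M] artanh_split_lipschitz_snd[of \<beta> \<nu> \<nu>' M] assms
      by (simp add: add_divide_distrib)
  next
    assume "\<alpha> + \<nu>' \<le> M"
    then show ?thesis
      using artanh_split_lipschitz_fst[of \<alpha> \<beta> \<nu>' M] artanh_split_lipschitz_snd[of \<alpha> \<nu> \<nu>' M] assms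
      by (simp add: add_divide_distrib)
  qed
qed

section \<open>The potential and its growth along curves\<close>

definition taxi_potential :: "real ^ 'n \<Rightarrow> real ^ 'n \<Rightarrow> real" where
  "taxi_potential p x = artanh (taxi_norm p) + artanh (taxi_norm x) - 2 * artanh (taxi_norm (min_point p x))"

text \<open>\<open>M\<close> is left free for two uses: a uniform bound along a curve gives absolute
  continuity, and the larger of two nearby norms gives the sharp bound on the derivative.\<close>

lemma taxi_potential_lipschitz:
  fixes p x y :: "real ^ 'n"
  assumes "taxi_norm x \<le> M" "taxi_norm y \<le> M" "M < 1"
  shows "\<bar>taxi_potential p y - taxi_potential p x\<bar> \<le> taxi_norm (y - x) / (1 - M\<^sup>2)"
proof -
  define \<mu> where "\<mu> z = taxi_norm (min_point p z)" for z
  have \<mu>: "\<mu> z = (\<Sum>i\<in>UNIV. \<bar>min_coord (p $ i) (z $ i)\<bar>)" for z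
    by (simp add: \<mu>_def taxi_norm_def min_point_def)
  have \<nu>: "taxi_norm z - \<mu> z = (\<Sum>i\<in>UNIV. \<bar>z $ i\<bar> - \<bar>min_coord (p $ i) (z $ i)\<bar>)" for z
    by (simp add: \<mu> taxi_norm_def sum_subtractf)
  have nonneg: "0 \<le> \<mu> z" "0 \<le> taxi_norm z - \<mu> z" for z
    unfolding \<nu> unfolding \<mu> by (simp_all add: sum_nonneg abs_min_coord_le)
  have "M\<^sup>2 < 1" using assms taxi_norm_nonneg[of x] by (simp add: abs_square_less_1)
  have "\<bar>taxi_potential p y - taxi_potential p x\<bar> =
      \<bar>(artanh (\<mu> y + (taxi_norm y - \<mu> y)) - 2 * artanh (\<mu> y)) - (artanh (\<mu> x + (taxi_norm x - \<mu> x)) - 2 * artanh (\<mu> x))\<bar>"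
    by (simp add: taxi_potential_def \<mu>_def)
  also have "\<dots> \<le> (\<bar>\<mu> y - \<mu> x\<bar> + \<bar>(taxi_norm y - \<mu> y) - (taxi_norm x - \<mu> x)\<bar>) / (1 - M\<^sup>2)"
    using assms nonneg by (intro artanh_split_lipschitz) auto
  also have "\<dots> \<le> taxi_norm (y - x) / (1 - M\<^sup>2)"
  proof (rule divide_right_mono)
    have "\<bar>\<mu> y - \<mu> x\<bar> \<le> (\<Sum>i\<in>UNIV. \<bar>\<bar>min_coord (p $ i) (y $ i)\<bar> - \<bar>min_coord (p $ i) (x $ i)\<bar>\<bar>)"
      unfolding \<mu> sum_subtractf[symmetric] by (rule sum_abs)
    moreover have "\<bar>(taxi_norm y - \<mu> y) - (taxi_norm x - \<mu> x)\<bar> \<le>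
      (\<Sum>i\<in>UNIV. \<bar>(\<bar>y $ i\<bar> - \<bar>min_coord (p $ i) (y $ i)\<bar>) - (\<bar>x $ i\<bar> - \<bar>min_coord (p $ i) (x $ i)\<bar>)\<bar>)"
      unfolding \<nu> sum_subtractf[symmetric] by (rule sum_abs)
    moreover have "(\<Sum>i\<in>UNIV. \<bar>\<bar>min_coord (p $ i) (y $ i)\<bar> - \<bar>min_coord (p $ i) (x $ i)\<bar>\<bar>) +
      (\<Sum>i\<in>UNIV. \<bar>(\<bar>y $ i\<bar> - \<bar>min_coord (p $ i) (y $ i)\<bar>) - (\<bar>x $ i\<bar> - \<bar>min_coord (p $ i) (x $ i)\<bar>)\<bar>) \<le> taxi_norm (y - x)"
      unfolding taxi_norm_def sum.distrib[symmetric] vector_minus_component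
      by (intro sum_mono min_coord_lipschitz_split)
    ultimately show "\<bar>\<mu> y - \<mu> x\<bar> + \<bar>(taxi_norm y - \<mu> y) - (taxi_norm x - \<mu> x)\<bar> \<le> taxi_norm (y - x)"
      by linarith
  qed (use \<open>M\<^sup>2 < 1\<close> in simp)
  finally show ?thesis .
qed

lemma has_vector_derivative_vec:
  fixes f :: "real \<Rightarrow> real ^ 'n"
  assumes "\<And>i. ((\<lambda>t. f t $ i) has_real_derivative f' $ i) (at x within S)"
  shows "(f has_vector_derivative f') (at x within S)"
  unfolding has_vector_derivative_def
proof (subst has_derivative_componentwise_within, rule ballI)
  fix b :: "real ^ 'n" assume "b \<in> Basis"
  then obtain i where b: "b = axis i 1" by (auto simp: Basis_vec_def)
  have "(\<lambda>t. f t \<bullet> b) = (\<lambda>t. f t $ i)" "(\<lambda>h. h *\<^sub>R f' \<bullet> b) = (*) (f' $ i)"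
    by (simp_all add: b inner_axis fun_eq_iff)
  then show "((\<lambda>t. f t \<bullet> b) has_derivative (\<lambda>h. h *\<^sub>R f' \<bullet> b)) (at x within S)"
    using has_field_derivative_imp_has_derivative[OF assms[of i]] by (simp only:)
qed

lemma taxi_potential_le_length:
  fixes p q :: "real ^ 'n"
  assumes "\<gamma> \<in> taxi_curves p q"
  shows "taxi_potential p q \<le> taxi_length \<gamma>"
proof -
  have ball: "taxi_norm (\<gamma> t) < 1" if "t \<in> {0..1}" for t
  proof -
    have "\<gamma> ` {0..1} \<subseteq> taxi_ball" using assms by (simp add: taxi_curves_def)
    then have "\<gamma> t \<in> taxi_ball" using that by blast
    then show ?thesis by (simp add: taxi_ball_def)
  qed
  have ac: "abs_continuous_on {0..1} (\<lambda>t. \<gamma> t $ i)" for i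
    using assms by (simp add: taxi_curves_def)
  have ends: "\<gamma> 0 = p" "\<gamma> 1 = q" using assms by (simp_all add: taxi_curves_def)
  have cont: "continuous_on {0..1} (\<lambda>t. taxi_norm (\<gamma> t))"
    unfolding taxi_norm_def
    by (intro continuous_on_sum continuous_on_rabs abs_continuous_on_imp_continuous_on ac)
  \<comment> \<open>Compactness keeps the curve away from the boundary of the ball, so one Lipschitz
    constant serves along all of it.\<close>
  obtain t0 :: real where t0: "t0 \<in> {0..1}" "\<And>t. t \<in> {0..1} \<Longrightarrow> taxi_norm (\<gamma> t) \<le> taxi_norm (\<gamma> t0)"
    using continuous_attains_sup[OF compact_Icc _ cont] by auto
  define R where "R = taxi_norm (\<gamma> t0)"
  have R: "R < 1" "\<And>t. t \<in> {0..1} \<Longrightarrow> taxi_norm (\<gamma> t) \<le> R"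
    using t0 ball by (auto simp: R_def)
  define h where "h t = taxi_potential p (\<gamma> t)" for t
  have ac_h: "abs_continuous_on {0..1} h"
  proof (rule abs_continuous_on_dominated[OF ac, where I = UNIV])
    fix s t :: real assume "s \<in> {0..1}" "t \<in> {0..1}"
    then have "\<bar>h t - h s\<bar> \<le> taxi_norm (\<gamma> t - \<gamma> s) / (1 - R\<^sup>2)"
      unfolding h_def using R by (intro taxi_potential_lipschitz) auto
    then show "\<bar>h t - h s\<bar> \<le> 1 / (1 - R\<^sup>2) * (\<Sum>i\<in>UNIV. \<bar>\<gamma> t $ i - \<gamma> s $ i\<bar>)"
      by (simp add: taxi_norm_def)
  qed auto
  have "\<exists>g N. g absolutely_integrable_on {0..1} \<and> negligible N \<and>
    (\<forall>x\<in>{0..1} - N. ((\<lambda>t. \<gamma> t $ i) has_real_derivative g x) (at x within {0..1}))" for i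
    using abs_continuous_fundamental_theorem[OF ac[of i] zero_le_one] by metis
  then obtain g N where g: "\<And>i. g i absolutely_integrable_on {0..1}" "\<And>i. negligible (N i)"
    "\<And>i x. x \<in> {0..1} - N i \<Longrightarrow> ((\<lambda>t. \<gamma> t $ i) has_real_derivative g i x) (at x within {0..1})"
    by metis
  obtain g0 N0 where g0: "(g0 has_integral (h 1 - h 0)) {0..1}" "negligible N0"
    "\<And>x. x \<in> {0..1} - N0 \<Longrightarrow> (h has_real_derivative g0 x) (at x within {0..1})"
    using abs_continuous_fundamental_theorem[OF ac_h zero_le_one] by metis
  define Z where "Z = N0 \<union> (\<Union>i. N i)"
  have "negligible Z" unfolding Z_def using g(2) g0(2) by (intro negligible_Un negligible_Union) auto
  define w where "w t = 1 / (1 - (taxi_norm (\<gamma> t))\<^sup>2) * (\<Sum>i\<in>UNIV. \<bar>g i t\<bar>)" for t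
  let ?W = "\<lambda>t. taxi_norm (vector_derivative \<gamma> (at t within {0..1})) / (1 - (taxi_norm (\<gamma> t))\<^sup>2)"
  have norm_sq: "(taxi_norm (\<gamma> t))\<^sup>2 < 1" if "t \<in> {0..1}" for t
    using ball[OF that] taxi_norm_nonneg[of "\<gamma> t"] by (simp add: abs_square_less_1)
  have W_eq: "?W t = w t" if t: "t \<in> {0..1} - Z" for t
  proof -
    have "(\<gamma> has_vector_derivative (\<chi> i. g i t)) (at t within {0..1})"
      by (rule has_vector_derivative_vec) (use t g(3) in \<open>auto simp: Z_def\<close>)
    then have "vector_derivative \<gamma> (at t within {0..1}) = (\<chi> i. g i t)"
      using t by (intro vector_derivative_within_cbox[where a = 0 and b = 1, unfolded box_real]) auto
    then show ?thesis by (simp add: w_def taxi_norm_def)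
  qed
  have cont': "continuous_on {0..1} (\<lambda>t. 1 / (1 - (taxi_norm (\<gamma> t))\<^sup>2))"
    using norm_sq by (intro continuous_intros cont) force
  \<comment> \<open>Integrability is proved for the explicit expression \<open>w\<close>, a bounded
    continuous factor times an integrable one, and then carried over to the actual integrand, which
    agrees with it off \<open>Z\<close>.\<close>
  have w_int: "w absolutely_integrable_on {0..1}"
    unfolding w_def[abs_def]
  proof (rule absolutely_integrable_bounded_measurable_product_real)
    show "(\<lambda>t. 1 / (1 - (taxi_norm (\<gamma> t))\<^sup>2)) \<in> borel_measurable (lebesgue_on {0..1})"
      using cont' by (intro continuous_imp_measurable_on_sets_lebesgue) auto
    show "bounded ((\<lambda>t. 1 / (1 - (taxi_norm (\<gamma> t))\<^sup>2)) ` {0..1})"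
      using compact_continuous_image[OF cont' compact_Icc] by (rule compact_imp_bounded)
    show "(\<lambda>t. \<Sum>i\<in>UNIV. \<bar>g i t\<bar>) absolutely_integrable_on {0..1}"
      using set_integrable_abs[OF g(1)] by (intro absolutely_integrable_sum) auto
  qed simp
  have W_int: "?W absolutely_integrable_on {0..1}"
    by (rule absolutely_integrable_spike[OF w_int \<open>negligible Z\<close> W_eq])
  have g0_le: "g0 t \<le> ?W t" if t: "t \<in> {0..1} - Z" for t
  proof -
    let ?F = "at t within {0..1::real}"
    have t': "t \<in> {0..1}" using t by simp
    have "((\<lambda>s. (h s - h t) / (s - t)) \<longlongrightarrow> g0 t) ?F"
      using g0(3)[of t] t unfolding has_field_derivative_iff Z_def by simp
    then have lim1: "((\<lambda>s. \<bar>(h s - h t) / (s - t)\<bar>) \<longlongrightarrow> \<bar>g0 t\<bar>) ?F"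
      by (rule tendsto_rabs)
    have norm_lim: "((\<lambda>s. taxi_norm (\<gamma> s)) \<longlongrightarrow> taxi_norm (\<gamma> t)) ?F"
      using cont t' by (simp add: continuous_on_def)
    have quot: "((\<lambda>s. (\<gamma> s $ i - \<gamma> t $ i) / (s - t)) \<longlongrightarrow> g i t) ?F" for i
      using g(3)[of t i] t unfolding has_field_derivative_iff Z_def by simp
    have sum_lim: "((\<lambda>s. \<Sum>i\<in>UNIV. \<bar>(\<gamma> s $ i - \<gamma> t $ i) / (s - t)\<bar>) \<longlongrightarrow> (\<Sum>i\<in>UNIV. \<bar>g i t\<bar>)) ?F"
      by (intro tendsto_sum tendsto_rabs quot)
    \<comment> \<open>With the larger of the two norms as \<open>M\<close>, the Lipschitz bound for
      the difference quotient tends to the integrand itself as \<open>s\<close> approaches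
      \<open>t\<close>.\<close>
    have "((\<lambda>s. (\<Sum>i\<in>UNIV. \<bar>(\<gamma> s $ i - \<gamma> t $ i) / (s - t)\<bar>) / (1 - (max (taxi_norm (\<gamma> s)) (taxi_norm (\<gamma> t)))\<^sup>2))
       \<longlongrightarrow> (\<Sum>i\<in>UNIV. \<bar>g i t\<bar>) / (1 - (max (taxi_norm (\<gamma> t)) (taxi_norm (\<gamma> t)))\<^sup>2)) ?F"
      using norm_sq[OF t']
      by (intro tendsto_divide[OF sum_lim] tendsto_diff tendsto_const tendsto_power tendsto_max norm_lim) auto
    then have lim2: "((\<lambda>s. (\<Sum>i\<in>UNIV. \<bar>(\<gamma> s $ i - \<gamma> t $ i) / (s - t)\<bar>) / (1 - (max (taxi_norm (\<gamma> s)) (taxi_norm (\<gamma> t)))\<^sup>2))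
       \<longlongrightarrow> w t) ?F" by (simp add: w_def)
    have ev: "\<forall>\<^sub>F s in ?F. \<bar>(h s - h t) / (s - t)\<bar> \<le>
       (\<Sum>i\<in>UNIV. \<bar>(\<gamma> s $ i - \<gamma> t $ i) / (s - t)\<bar>) / (1 - (max (taxi_norm (\<gamma> s)) (taxi_norm (\<gamma> t)))\<^sup>2)"
      unfolding eventually_at_filter
    proof (intro always_eventually allI impI)
      \<comment> \<open>At \<open>s = t\<close> both sides are 0 by the convention for division by
        zero.\<close>
      fix s :: real assume "s \<in> {0..1}"
      then have "\<bar>h s - h t\<bar> \<le> taxi_norm (\<gamma> s - \<gamma> t) / (1 - (max (taxi_norm (\<gamma> s)) (taxi_norm (\<gamma> t)))\<^sup>2)"
        unfolding h_def using ball t' by (intro taxi_potential_lipschitz) auto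
      then have "\<bar>h s - h t\<bar> / \<bar>s - t\<bar> \<le> taxi_norm (\<gamma> s - \<gamma> t) / (1 - (max (taxi_norm (\<gamma> s)) (taxi_norm (\<gamma> t)))\<^sup>2) / \<bar>s - t\<bar>"
        by (rule divide_right_mono) simp
      also have "\<dots> = taxi_norm (\<gamma> s - \<gamma> t) / \<bar>s - t\<bar> / (1 - (max (taxi_norm (\<gamma> s)) (taxi_norm (\<gamma> t)))\<^sup>2)"
        by simp
      also have "taxi_norm (\<gamma> s - \<gamma> t) / \<bar>s - t\<bar> = (\<Sum>i\<in>UNIV. \<bar>(\<gamma> s $ i - \<gamma> t $ i) / (s - t)\<bar>)"
        by (simp add: taxi_norm_def sum_divide_distrib abs_divide)
      finally show "\<bar>(h s - h t) / (s - t)\<bar> \<le>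
       (\<Sum>i\<in>UNIV. \<bar>(\<gamma> s $ i - \<gamma> t $ i) / (s - t)\<bar>) / (1 - (max (taxi_norm (\<gamma> s)) (taxi_norm (\<gamma> t)))\<^sup>2)"
        by (simp add: abs_divide)
    qed
    have "?F \<noteq> bot" using t' by (simp add: trivial_limit_within)
    then have "\<bar>g0 t\<bar> \<le> w t" using tendsto_le[OF _ lim2 lim1] ev by blast
    then show ?thesis using W_eq[OF t] by simp
  qed
  \<comment> \<open>The curve starts at \<open>p\<close>, and
    \<open>min_point p p = p\<close>.\<close>
  have "h 0 = 0"
    by (simp add: h_def ends taxi_potential_def min_point_def min_coord_def sgn_mult_abs)
  then have "taxi_potential p q = integral {0..1} g0"
    using integral_unique[OF g0(1)] by (simp add: h_def ends)
  \<comment> \<open>Changing the values on the null set \<open>Z\<close> makes the comparison of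
    integrands hold everywhere.\<close>
  also have "\<dots> = integral {0..1} (\<lambda>t. if t \<in> Z then ?W t else g0 t)"
    by (rule integral_spike[OF \<open>negligible Z\<close>]) simp
  also have "\<dots> \<le> integral {0..1} ?W"
  proof (rule integral_le)
    show "(\<lambda>t. if t \<in> Z then ?W t else g0 t) integrable_on {0..1}"
      using has_integral_integrable[OF g0(1)] by (rule integrable_spike[OF _ \<open>negligible Z\<close>]) simp
    show "?W integrable_on {0..1}" using W_int by (rule set_lebesgue_integral_eq_integral(1))
  qed (use g0_le in auto)
  also have "\<dots> = taxi_length \<gamma>"
    unfolding taxi_length_def using set_lebesgue_integral_eq_integral(2)[OF W_int] by simp
  finally show ?thesis .
qed

section \<open>A curve of minimal length\<close>

lemma abs_convex_combination_same_sign: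
  fixes x y s :: real
  assumes "0 \<le> x * y" "0 \<le> s" "s \<le> 1"
  shows "\<bar>x + s * (y - x)\<bar> = \<bar>x\<bar> + s * (\<bar>y\<bar> - \<bar>x\<bar>)"
proof -
  have eq: "x + s * (y - x) = (1 - s) * x + s * y" "\<bar>x\<bar> + s * (\<bar>y\<bar> - \<bar>x\<bar>) = (1 - s) * \<bar>x\<bar> + s * \<bar>y\<bar>"
    by (simp_all add: algebra_simps)
  from assms(1) consider "0 \<le> x" "0 \<le> y" | "x \<le> 0" "y \<le> 0" by (auto simp: zero_le_mult_iff)
  then show ?thesis
  proof cases
    case 1
    then have "0 \<le> (1 - s) * x + s * y" using assms by simp
    with 1 show ?thesis unfolding eq by simp
  next
    case 2
    then have "(1 - s) * x \<le> 0" "s * y \<le> 0" using assms by (auto simp: mult_nonneg_nonpos)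
    then have "(1 - s) * x + s * y \<le> 0" by simp
    with 2 show ?thesis unfolding eq by simp
  qed
qed

lemma min_coord_same_sign: "0 \<le> x * min_coord x y" "0 \<le> min_coord x y * y"
  by (auto simp: min_coord_def sgn_if min_def mult_le_0_iff zero_le_mult_iff)

text \<open>\<open>min_coord x y\<close> lies between 0 and each of \<open>x\<close> and
  \<open>y\<close>.\<close>

lemma abs_diff_min_coord:
  "\<bar>x - min_coord x y\<bar> = \<bar>x\<bar> - \<bar>min_coord x y\<bar>" "\<bar>y - min_coord x y\<bar> = \<bar>y\<bar> - \<bar>min_coord x y\<bar>"
  by (auto simp: min_coord_def sgn_if min_def split: if_splits)

text \<open>Without sign changes the norm is affine along the segment, and by \<open>norm\<close>
  the speed is \<open>\<sigma>\<close> times its derivative; so the integrand is the derivative of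
  \<open>\<sigma> * artanh\<close> of the norm. In use \<open>\<sigma>\<close> is -1 where the norm
  falls and 1 where it rises.\<close>

lemma segment_integrand_has_integral:
  fixes \<gamma> :: "real \<Rightarrow> real ^ 'n" and x y :: "real ^ 'n"
  assumes cd: "0 \<le> c" "c < d" "d \<le> 1"
    and \<gamma>: "\<And>t. t \<in> {c..d} \<Longrightarrow> \<gamma> t = x + ((t - c) / (d - c)) *\<^sub>R (y - x)"
    and sign: "\<And>i. 0 \<le> x $ i * y $ i"
    and norm: "taxi_norm (y - x) = \<sigma> * (taxi_norm y - taxi_norm x)"
    and ball: "taxi_norm x < 1" "taxi_norm y < 1"
  shows "((\<lambda>t. taxi_norm (vector_derivative \<gamma> (at t within {0..1})) / (1 - (taxi_norm (\<gamma> t))\<^sup>2))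
     has_integral \<sigma> * (artanh (taxi_norm y) - artanh (taxi_norm x))) {c..d}"
    and "\<And>t. t \<in> {c..d} \<Longrightarrow> taxi_norm (\<gamma> t) < 1"
proof -
  define s where "s t = (t - c) / (d - c)" for t
  define n where "n t = taxi_norm x + s t * (taxi_norm y - taxi_norm x)" for t
  have s01: "0 \<le> s t" "s t \<le> 1" if "t \<in> {c..d}" for t using that cd by (auto simp: s_def)
  have n: "taxi_norm (\<gamma> t) = n t" if t: "t \<in> {c..d}" for t
  proof -
    have "taxi_norm (\<gamma> t) = (\<Sum>i\<in>UNIV. \<bar>x $ i + s t * (y $ i - x $ i)\<bar>)"
      unfolding taxi_norm_def \<gamma>[OF t] s_def by simp
    also have "\<dots> = (\<Sum>i\<in>UNIV. \<bar>x $ i\<bar> + s t * (\<bar>y $ i\<bar> - \<bar>x $ i\<bar>))"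
      by (intro sum.cong refl abs_convex_combination_same_sign sign s01[OF t])
    also have "\<dots> = n t"
      unfolding n_def taxi_norm_def by (simp only: sum.distrib sum_subtractf sum_distrib_left[symmetric])
    finally show ?thesis .
  qed
  have n_bounds: "0 \<le> n t" "n t < 1" if t: "t \<in> {c..d}" for t
  proof -
    show "0 \<le> n t" unfolding n[OF t, symmetric] by (simp add: taxi_norm_def sum_nonneg)
    have "n t = (1 - s t) * taxi_norm x + s t * taxi_norm y" by (simp add: n_def algebra_simps)
    also have "\<dots> < 1" using s01[OF t] ball by (intro convex_bound_lt) auto
    finally show "n t < 1" .
  qed
  show "taxi_norm (\<gamma> t) < 1" if "t \<in> {c..d}" for t using n n_bounds that by simp
  let ?W = "\<lambda>t. taxi_norm (vector_derivative \<gamma> (at t within {0..1})) / (1 - (taxi_norm (\<gamma> t))\<^sup>2)"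
  \<comment> \<open>Only interior times are considered, since the whole curve may have a kink at
    \<open>c\<close> or \<open>d\<close>; continuity there suffices for the fundamental
    theorem.\<close>
  have der: "((\<lambda>t. \<sigma> * artanh (n t)) has_vector_derivative ?W t) (at t)" if t: "t \<in> {c<..<d}" for t
  proof -
    have t': "t \<in> {c..d}" using t by simp
    have "((\<lambda>t. x + ((t - c) / (d - c)) *\<^sub>R (y - x)) has_vector_derivative (1 / (d - c)) *\<^sub>R (y - x)) (at t)"
      by (auto intro!: derivative_eq_intros simp: divide_inverse)
    then have "(\<gamma> has_vector_derivative (1 / (d - c)) *\<^sub>R (y - x)) (at t)"
      by (rule has_vector_derivative_transform_within_open[where S = "{c<..<d}"]) (use t \<gamma> in auto)
    then have "(\<gamma> has_vector_derivative (1 / (d - c)) *\<^sub>R (y - x)) (at t within {0..1})"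
      by (rule has_vector_derivative_at_within)
    then have "vector_derivative \<gamma> (at t within {0..1}) = (1 / (d - c)) *\<^sub>R (y - x)"
      using t cd by (intro vector_derivative_within_cbox[where a = 0 and b = 1, unfolded box_real]) auto
    moreover have "taxi_norm ((1 / (d - c)) *\<^sub>R (y - x)) = taxi_norm (y - x) / (d - c)"
      using cd by (simp add: taxi_norm_def abs_mult sum_divide_distrib)
    ultimately have W: "?W t = \<sigma> * ((taxi_norm y - taxi_norm x) / (d - c) / (1 - (n t)\<^sup>2))"
      using norm n[OF t'] by simp
    have "(n has_real_derivative (taxi_norm y - taxi_norm x) / (d - c)) (at t)"
      unfolding n_def s_def using cd by (auto intro!: derivative_eq_intros)
    then have "((\<lambda>t. artanh (n t)) has_real_derivative 1 / (1 - (n t)\<^sup>2) * ((taxi_norm y - taxi_norm x) / (d - c))) (at t)"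
      using n_bounds[OF t'] by (intro DERIV_chain2[OF artanh_real_has_field_derivative]) auto
    from DERIV_cmult[OF this, of \<sigma>] show ?thesis
      unfolding W has_real_derivative_iff_has_vector_derivative[symmetric] by (simp add: mult.commute)
  qed
  have "continuous_on {c..d} (\<lambda>t. \<sigma> * artanh (n t))"
  proof -
    have "continuous_on {c..d} n" unfolding n_def s_def using cd by (intro continuous_intros) auto
    moreover have "\<bar>n t\<bar> < 1" if "t \<in> {c..d}" for t using n_bounds[OF that] by simp
    then have "n t \<in> {-1<..<1}" if "t \<in> {c..d}" for t using that by (auto simp: abs_less_iff)
    ultimately show ?thesis
      by (intro continuous_on_mult continuous_on_const continuous_on_artanh')
  qed
  then have "(?W has_integral (\<sigma> * artanh (n d) - \<sigma> * artanh (n c))) {c..d}"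
    using cd der by (intro fundamental_theorem_of_calculus_interior_strong[of "{}"]) auto
  moreover have "n d = taxi_norm y" "n c = taxi_norm x" using cd by (simp_all add: n_def s_def)
  ultimately show "(?W has_integral \<sigma> * (artanh (taxi_norm y) - artanh (taxi_norm x))) {c..d}"
    by (simp add: algebra_simps)
qed

lemma taxi_curve_through_min_point:
  fixes p q :: "real ^ 'n"
  assumes "p \<in> taxi_ball" "q \<in> taxi_ball"
  obtains \<gamma> where "\<gamma> \<in> taxi_curves p q"
    "taxi_length \<gamma> = artanh (taxi_norm p) + artanh (taxi_norm q) - 2 * artanh (taxi_norm (min_point p q))"
proof -
  define m where "m = min_point p q"
  have m: "m $ i = min_coord (p $ i) (q $ i)" for i by (simp add: m_def min_point_def)
  \<comment> \<open>Only the first \<open>max\<close> term can be nonzero before time 1/2 and only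
    the second after it: \<open>p\<close> to \<open>m\<close>, then \<open>m\<close> to
    \<open>q\<close>, in one formula with Lipschitz components.\<close>
  define \<gamma> where "\<gamma> t = m + max 0 (1 - 2 * t) *\<^sub>R (p - m) + max 0 (2 * t - 1) *\<^sub>R (q - m)" for t :: real
  have pq: "taxi_norm p < 1" "taxi_norm q < 1" using assms by (auto simp: taxi_ball_def)
  have norm_pm: "taxi_norm (m - p) = (-1) * (taxi_norm m - taxi_norm p)"
    by (simp add: taxi_norm_def m abs_minus_commute[of "min_coord _ _"] abs_diff_min_coord sum_subtractf)
  have norm_mq: "taxi_norm (q - m) = 1 * (taxi_norm q - taxi_norm m)"
    by (simp add: taxi_norm_def m abs_diff_min_coord sum_subtractf)
  have "taxi_norm m \<le> taxi_norm p"
    unfolding taxi_norm_def m by (intro sum_mono abs_min_coord_le)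
  then have "taxi_norm m < 1" using pq by simp
  let ?W = "\<lambda>t. taxi_norm (vector_derivative \<gamma> (at t within {0..1})) / (1 - (taxi_norm (\<gamma> t))\<^sup>2)"
  have "\<gamma> t = p + ((t - 0) / (1/2 - 0)) *\<^sub>R (m - p)" if "t \<in> {0..1/2}" for t
    using that by (simp add: \<gamma>_def algebra_simps)
  note first = segment_integrand_has_integral[OF _ _ _ this _ norm_pm pq(1) \<open>taxi_norm m < 1\<close>]
  have "\<gamma> t = m + ((t - 1/2) / (1 - 1/2)) *\<^sub>R (q - m)" if "t \<in> {1/2..1}" for t
    using that by (simp add: \<gamma>_def algebra_simps)
  note second = segment_integrand_has_integral[OF _ _ _ this _ norm_mq \<open>taxi_norm m < 1\<close> pq(2)]
  have "(?W has_integral ((-1) * (artanh (taxi_norm m) - artanh (taxi_norm p)) + 1 * (artanh (taxi_norm q) - artanh (taxi_norm m)))) {0..1}"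
    by (rule has_integral_combine[OF _ _ first(1) second(1)]) (simp_all add: m min_coord_same_sign)
  then have W: "(?W has_integral (artanh (taxi_norm p) + artanh (taxi_norm q) - 2 * artanh (taxi_norm m))) {0..1}"
    by (simp add: algebra_simps)
  have in_ball: "taxi_norm (\<gamma> t) < 1" if "t \<in> {0..1}" for t
  proof (cases "t \<le> 1/2")
    case True
    then show ?thesis using that by (intro first(2)) (simp_all add: m min_coord_same_sign)
  next
    case False
    then show ?thesis using that by (intro second(2)) (simp_all add: m min_coord_same_sign)
  qed
  \<comment> \<open>Nonnegativity upgrades gauge integrability to absolute integrability, so that
    the Lebesgue integral in \<open>taxi_length\<close> has the computed value.\<close>
  have "0 \<le> ?W t" if "t \<in> {0..1}" for t
    using in_ball[OF that]
    by (intro divide_nonneg_nonneg) (auto simp: taxi_norm_def sum_nonneg abs_square_le_1)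
  then have "?W absolutely_integrable_on {0..1}"
    using W by (intro nonnegative_absolutely_integrable_1) auto
  then have "taxi_length \<gamma> = integral {0..1} ?W"
    unfolding taxi_length_def by (rule set_lebesgue_integral_eq_integral(2))
  also have "\<dots> = artanh (taxi_norm p) + artanh (taxi_norm q) - 2 * artanh (taxi_norm m)"
    using W by (rule integral_unique)
  finally have length: "taxi_length \<gamma> = artanh (taxi_norm p) + artanh (taxi_norm q) - 2 * artanh (taxi_norm m)" .
  have "abs_continuous_on {0..1} (\<lambda>t. \<gamma> t $ i)" for i
  proof (rule abs_continuous_on_lipschitz[where C = "2 * \<bar>p $ i - m $ i\<bar> + 2 * \<bar>q $ i - m $ i\<bar>"])
    fix t u :: real
    define A where "A = max 0 (1 - 2 * u) - max 0 (1 - 2 * t)"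
    define B where "B = max 0 (2 * u - 1) - max 0 (2 * t - 1)"
    have AB: "\<bar>A\<bar> \<le> 2 * \<bar>u - t\<bar>" "\<bar>B\<bar> \<le> 2 * \<bar>u - t\<bar>" unfolding A_def B_def by (auto simp: max_def abs_if)
    have "\<gamma> u $ i - \<gamma> t $ i = A * (p $ i - m $ i) + B * (q $ i - m $ i)"
      by (simp add: \<gamma>_def A_def B_def algebra_simps)
    then have "\<bar>\<gamma> u $ i - \<gamma> t $ i\<bar> \<le> \<bar>A\<bar> * \<bar>p $ i - m $ i\<bar> + \<bar>B\<bar> * \<bar>q $ i - m $ i\<bar>"
      by (simp add: abs_mult[symmetric] abs_triangle_ineq)
    also have "\<dots> \<le> 2 * \<bar>u - t\<bar> * \<bar>p $ i - m $ i\<bar> + 2 * \<bar>u - t\<bar> * \<bar>q $ i - m $ i\<bar>"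
      using AB by (intro add_mono mult_right_mono) auto
    finally show "\<bar>\<gamma> u $ i - \<gamma> t $ i\<bar> \<le> (2 * \<bar>p $ i - m $ i\<bar> + 2 * \<bar>q $ i - m $ i\<bar>) * \<bar>u - t\<bar>"
      by (simp add: algebra_simps)
  qed
  then have "\<gamma> \<in> taxi_curves p q"
    using in_ball by (auto simp: taxi_curves_def taxi_ball_def \<gamma>_def)
  with length show ?thesis unfolding m_def by (rule that[rotated])
qed

theorem theorem2:
  fixes p q :: "real ^ 'n"
  assumes "CARD('n) \<ge> 2"
    and "p \<in> taxi_ball" and "q \<in> taxi_ball"
  shows "taxi_dist p q =
    artanh (taxi_norm p) + artanh (taxi_norm q) - 2 * artanh (taxi_norm (min_point p q))"
proof -
  obtain \<gamma> where \<gamma>: "\<gamma> \<in> taxi_curves p q" "taxi_length \<gamma> = taxi_potential p q"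
    using taxi_curve_through_min_point[OF assms(2,3)] unfolding taxi_potential_def by metis
  have "taxi_dist p q = taxi_potential p q"
    unfolding taxi_dist_def
  proof (rule antisym)
    \<comment> \<open>The lower bound also guarantees that the infimum over the reals is at most
      each of its members.\<close>
    have "bdd_below (taxi_length ` taxi_curves p q)"
      by (rule bdd_belowI2) (rule taxi_potential_le_length)
    then show "(INF \<gamma>\<in>taxi_curves p q. taxi_length \<gamma>) \<le> taxi_potential p q"
      using cINF_lower[OF _ \<gamma>(1)] \<gamma>(2) by metis
    show "taxi_potential p q \<le> (INF \<gamma>\<in>taxi_curves p q. taxi_length \<gamma>)"
      using \<gamma>(1) by (intro cINF_greatest taxi_potential_le_length) auto
  qed
  then show ?thesis by (simp add: taxi_potential_def)
qed

end
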